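(* Fix an integer $\ell \geq 2$ and a real $\rho > 0$. There exist constants $N = N(\ell,\rho)$ and $K = K(\ell,\rho)$ such that the following hold for all integers $\kappa_1,\ldots,\kappa_\ell \geq \rho n$ summing to $n \geq N$ (with $\kappa_i$ positive). (1) If $f\colon \mathcal{U}_\kappa \to \mathbb{R}$ is a degree 1 function and $\mathbb{E}[\operatorname{dist}(f,\{0,1\})^2] = \epsilon$, then there exists a Boolean function $g\colon \mathcal{U}_\kappa \to \{0,1\}$, depending on a single coordinate, such that $\mathbb{E}[(f-g)^2] \leq \epsilon + K\epsilon^2$. (2) If $F\colon \mathcal{U}_\kappa \to \{0,1\}$ satisfies $\|F^{>1}\|^2 = \epsilon$, then there exists a Boolean function $g\colon \mathcal{U}_\kappa \to \{0,1\}$, depending on a single coordinate, such that $\Pr[F \neq g] \leq 4\epsilon + K\epsilon^2$.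
   Context: For positive integers $\kappa_1,\ldots,\kappa_\ell$ summing to $n$, the multislice $\mathcal{U}_\kappa$ is the set of all $u \in [\ell]^n$ in which exactly $\kappa_i$ coordinates equal $i$, for every $i \in [\ell]$. It carries the uniform probability measure; $\mathbb{E}$ and $\Pr$ are with respect to it, and $\|f\| = \sqrt{\mathbb{E}[f^2]}$. For a real $x$ and a finite set $S$, $\operatorname{dist}(x,S) = \min_{y\in S}|x-y|$. For $j \in [n]$, $i \in [\ell]$ let $x_{ji}\colon \mathcal{U}_\kappa \to \{0,1\}$ be $x_{ji}(u) = 1$ if $u_j = i$ and $0$ otherwise. A function on $\mathcal{U}_\kappa$ is a degree 1 function if it can be written as a polynomial of degree at most 1 in the variables $x_{ji}$. Equivalently, it is a linear combination of functions each depending on a single coordinate (constants included); equivalently, it lies in $V^{(n)} \oplus V^{(n-1,1)}$, where $V^\lambda$ denotes the isotypic component, corresponding to the partition $\lambda$ of $n$, of the permutation representation of $S_n$ on $\mathbb{R}^{\mathcal{U}_\kappa}$ ($S_n$ acting by permuting coordinates). For $F\colon \mathcal{U}_\kappa \to \mathbb{R}$, $F^{\le 1}$ is the orthogonal projection of $F$ to $V^{(n)} \oplus V^{(n-1,1)}$ (the space of degree 1 functions) and $F^{>1} = F - F^{\leq 1}$. A function depends on a single coordinate if there is $j \in [n]$ such that its value at $u$ is determined by $u_j$; constant functions are included. *)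

theory Defs
  imports "HOL-Probability.Probability"
begin

definition multislice :: "nat \<Rightarrow> nat \<Rightarrow> (nat \<Rightarrow> nat) \<Rightarrow> (nat \<Rightarrow> nat) set" where
  "multislice l n \<kappa> =
     {u \<in> {1..n} \<rightarrow>\<^sub>E {1..l}. \<forall>i\<in>{1..l}. card {j \<in> {1..n}. u j = i} = \<kappa> i}"

definition ms_pmf :: "nat \<Rightarrow> nat \<Rightarrow> (nat \<Rightarrow> nat) \<Rightarrow> (nat \<Rightarrow> nat) pmf" where
  "ms_pmf l n \<kappa> = pmf_of_set (multislice l n \<kappa>)"

abbreviation ms_expectation ::
  "nat \<Rightarrow> nat \<Rightarrow> (nat \<Rightarrow> nat) \<Rightarrow> ((nat \<Rightarrow> nat) \<Rightarrow> real) \<Rightarrow> real" where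
  "ms_expectation l n \<kappa> \<equiv> measure_pmf.expectation (ms_pmf l n \<kappa>)"

abbreviation ms_prob ::
  "nat \<Rightarrow> nat \<Rightarrow> (nat \<Rightarrow> nat) \<Rightarrow> (nat \<Rightarrow> nat) set \<Rightarrow> real" where
  "ms_prob l n \<kappa> \<equiv> measure_pmf.prob (ms_pmf l n \<kappa>)"

definition ms_norm ::
  "nat \<Rightarrow> nat \<Rightarrow> (nat \<Rightarrow> nat) \<Rightarrow> ((nat \<Rightarrow> nat) \<Rightarrow> real) \<Rightarrow> real" where
  "ms_norm l n \<kappa> f = sqrt (ms_expectation l n \<kappa> (\<lambda>u. (f u)\<^sup>2))"

definition coord_var :: "nat \<Rightarrow> nat \<Rightarrow> (nat \<Rightarrow> nat) \<Rightarrow> real" where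
  "coord_var j i u = (if u j = i then 1 else 0)"

text \<open>
  A function on the multislice is a HOL function of which only the values on
  \<^term>\<open>multislice l n \<kappa>\<close> matter. A polynomial of degree at most 1 in the variables
  \<^term>\<open>coord_var j i\<close> is a constant plus a linear combination of these variables.
\<close>

definition degree1 ::
  "nat \<Rightarrow> nat \<Rightarrow> (nat \<Rightarrow> nat) \<Rightarrow> ((nat \<Rightarrow> nat) \<Rightarrow> real) \<Rightarrow> bool" where
  "degree1 l n \<kappa> f \<longleftrightarrow>
     (\<exists>(c::real) (a::nat \<Rightarrow> nat \<Rightarrow> real). \<forall>u\<in>multislice l n \<kappa>.
        f u = c + (\<Sum>j=1..n. \<Sum>i=1..l. a j i * coord_var j i u))"

text \<open>
  Orthogonal projection to the space of degree 1 functions. Extensionality, i.e. the value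
  \<^term>\<open>undefined\<close> off the multislice, only serves to make the projection unique as a HOL
  function; it exists uniquely for a nonempty multislice by \<open>degree1_proj_unique_exists\<close> below.
\<close>

definition is_degree1_proj :: "nat \<Rightarrow> nat \<Rightarrow> (nat \<Rightarrow> nat) \<Rightarrow>
    ((nat \<Rightarrow> nat) \<Rightarrow> real) \<Rightarrow> ((nat \<Rightarrow> nat) \<Rightarrow> real) \<Rightarrow> bool" where
  "is_degree1_proj l n \<kappa> F p \<longleftrightarrow>
     p \<in> extensional (multislice l n \<kappa>) \<and> degree1 l n \<kappa> p \<and>
     (\<forall>h. degree1 l n \<kappa> h \<longrightarrow> ms_expectation l n \<kappa> (\<lambda>u. (F u - p u) * h u) = 0)"

definition proj_le1 :: "nat \<Rightarrow> nat \<Rightarrow> (nat \<Rightarrow> nat) \<Rightarrow>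
    ((nat \<Rightarrow> nat) \<Rightarrow> real) \<Rightarrow> (nat \<Rightarrow> nat) \<Rightarrow> real" where
  "proj_le1 l n \<kappa> F = (THE p. is_degree1_proj l n \<kappa> F p)"

definition proj_gt1 :: "nat \<Rightarrow> nat \<Rightarrow> (nat \<Rightarrow> nat) \<Rightarrow>
    ((nat \<Rightarrow> nat) \<Rightarrow> real) \<Rightarrow> (nat \<Rightarrow> nat) \<Rightarrow> real" where
  "proj_gt1 l n \<kappa> F = (\<lambda>u. F u - proj_le1 l n \<kappa> F u)"

definition depends_single_coord ::
  "nat \<Rightarrow> nat \<Rightarrow> (nat \<Rightarrow> nat) \<Rightarrow> ((nat \<Rightarrow> nat) \<Rightarrow> real) \<Rightarrow> bool" where
  "depends_single_coord l n \<kappa> g \<longleftrightarrow>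
     (\<exists>j\<in>{1..n}. \<forall>u\<in>multislice l n \<kappa>. \<forall>v\<in>multislice l n \<kappa>. u j = v j \<longrightarrow> g u = g v)"

lemma finite_multislice: "finite (multislice l n \<kappa>)"
proof -
  have "multislice l n \<kappa> \<subseteq> {1..n} \<rightarrow>\<^sub>E {1..l}"
    by (auto simp: multislice_def)
  then show ?thesis
    by (rule finite_subset) (auto intro: finite_PiE)
qed

lemma ms_expectation_sum:
  assumes "multislice l n \<kappa> \<noteq> {}"
  shows "ms_expectation l n \<kappa> f =
    (\<Sum>u\<in>multislice l n \<kappa>. f u) / real (card (multislice l n \<kappa>))"
  unfolding ms_pmf_def using assms finite_multislice by (simp add: integral_pmf_of_set)

lemma orthogonal_projection_exists:
  fixes F :: "'a \<Rightarrow> real" and \<phi> :: "'b \<Rightarrow> 'a \<Rightarrow> real"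
  assumes "finite U" "finite I"
  shows "\<exists>a. \<forall>k\<in>I. (\<Sum>u\<in>U. (F u - (\<Sum>i\<in>I. a i * \<phi> i u)) * \<phi> k u) = 0"
  using \<open>finite I\<close>
proof (induction I arbitrary: F rule: finite_induct)
  case empty
  then show ?case by simp
next
  case (insert m I)
  obtain c where c: "\<forall>k\<in>I. (\<Sum>u\<in>U. (\<phi> m u - (\<Sum>i\<in>I. c i * \<phi> i u)) * \<phi> k u) = 0"
    using insert.IH by blast
  obtain b where b: "\<forall>k\<in>I. (\<Sum>u\<in>U. (F u - (\<Sum>i\<in>I. b i * \<phi> i u)) * \<phi> k u) = 0"
    using insert.IH by blast
  define r where "r u = \<phi> m u - (\<Sum>i\<in>I. c i * \<phi> i u)" for u
  define s where "s u = F u - (\<Sum>i\<in>I. b i * \<phi> i u)" for u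
  define t where "t = (\<Sum>u\<in>U. s u * r u) / (\<Sum>u\<in>U. r u * r u)"
  define a where "a i = (if i = m then t else b i - t * c i)" for i
  have r0: "(\<Sum>u\<in>U. r u * \<phi> k u) = 0" if "k \<in> I" for k
    using c that by (simp add: r_def)
  have s0: "(\<Sum>u\<in>U. s u * \<phi> k u) = 0" if "k \<in> I" for k
    using b that by (simp add: s_def)
  have aI: "(\<Sum>i\<in>I. a i * \<phi> i u) = (\<Sum>i\<in>I. b i * \<phi> i u) - t * (\<Sum>i\<in>I. c i * \<phi> i u)" for u
  proof -
    have "(\<Sum>i\<in>I. a i * \<phi> i u) = (\<Sum>i\<in>I. b i * \<phi> i u - t * (c i * \<phi> i u))"
      using insert.hyps by (intro sum.cong) (auto simp: a_def algebra_simps)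
    then show ?thesis
      by (simp add: sum_subtractf sum_distrib_left)
  qed
  have res: "F u - (\<Sum>i\<in>insert m I. a i * \<phi> i u) = s u - t * r u" for u
    using insert.hyps aI[of u] by (simp add: a_def r_def s_def algebra_simps)
  have ort: "(\<Sum>u\<in>U. (s u - t * r u) * \<phi> k u) = 0" if "k \<in> I" for k
  proof -
    have "(\<Sum>u\<in>U. (s u - t * r u) * \<phi> k u)
        = (\<Sum>u\<in>U. s u * \<phi> k u) - t * (\<Sum>u\<in>U. r u * \<phi> k u)"
      by (simp add: algebra_simps sum_subtractf sum_distrib_left)
    then show ?thesis using r0[OF that] s0[OF that] by simp
  qed
  have ortr: "(\<Sum>u\<in>U. (s u - t * r u) * r u) = 0"
  proof -
    have eq: "(\<Sum>u\<in>U. (s u - t * r u) * r u)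
        = (\<Sum>u\<in>U. s u * r u) - t * (\<Sum>u\<in>U. r u * r u)"
      by (simp add: algebra_simps sum_subtractf sum_distrib_left)
    show ?thesis
    proof (cases "(\<Sum>u\<in>U. r u * r u) = 0")
      case True
      then have "\<forall>u\<in>U. r u * r u = 0"
        using \<open>finite U\<close> by (subst (asm) sum_nonneg_eq_0_iff) auto
      then show ?thesis by simp
    next
      case False
      then show ?thesis using eq by (simp add: t_def)
    qed
  qed
  have "(\<Sum>u\<in>U. (s u - t * r u) * \<phi> m u) = 0"
  proof -
    have "(\<Sum>u\<in>U. (s u - t * r u) * \<phi> m u)
        = (\<Sum>u\<in>U. (s u - t * r u) * r u + (\<Sum>i\<in>I. c i * ((s u - t * r u) * \<phi> i u)))"
    proof (intro sum.cong refl)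
      fix u
      have "\<phi> m u = r u + (\<Sum>i\<in>I. c i * \<phi> i u)" by (simp add: r_def)
      then have "(s u - t * r u) * \<phi> m u
          = (s u - t * r u) * r u + (s u - t * r u) * (\<Sum>i\<in>I. c i * \<phi> i u)"
        by (simp only: distrib_left)
      then show "(s u - t * r u) * \<phi> m u
          = (s u - t * r u) * r u + (\<Sum>i\<in>I. c i * ((s u - t * r u) * \<phi> i u))"
        by (simp add: sum_distrib_left mult.left_commute)
    qed
    also have "\<dots> = (\<Sum>u\<in>U. (s u - t * r u) * r u)
        + (\<Sum>i\<in>I. c i * (\<Sum>u\<in>U. (s u - t * r u) * \<phi> i u))"
      by (simp only: sum.distrib sum_distrib_left sum.swap[of _ I U])
    also have "\<dots> = 0" using ort ortr by simp
    finally show ?thesis .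
  qed
  then have "\<forall>k\<in>insert m I. (\<Sum>u\<in>U. (F u - (\<Sum>i\<in>insert m I. a i * \<phi> i u)) * \<phi> k u) = 0"
    using ort unfolding res by blast
  then show ?case by blast
qed

lemma degree1_proj_unique_exists:
  assumes ne: "multislice l n \<kappa> \<noteq> {}"
  shows "\<exists>!p. is_degree1_proj l n \<kappa> F p"
proof -
  let ?U = "multislice l n \<kappa>"
  have E0: "ms_expectation l n \<kappa> f = 0 \<longleftrightarrow> (\<Sum>u\<in>?U. f u) = 0" for f
    using ne finite_multislice[of l n \<kappa>] by (simp add: ms_expectation_sum)
  define I where "I = insert None (Some ` ({1..n} \<times> {1..l}))"
  define \<phi> where "\<phi> k u = (case k of None \<Rightarrow> 1 | Some (j, i) \<Rightarrow> coord_var j i u)"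
    for k :: "(nat \<times> nat) option" and u
  have sumI: "(\<Sum>k\<in>I. a k * \<phi> k u)
      = a None + (\<Sum>j=1..n. \<Sum>i=1..l. a (Some (j, i)) * coord_var j i u)" for a u
    unfolding I_def \<phi>_def
    by (subst sum.insert) (auto simp: sum.reindex sum.cartesian_product case_prod_unfold)
  have deg: "degree1 l n \<kappa> h \<longleftrightarrow> (\<exists>a. \<forall>u\<in>?U. h u = (\<Sum>k\<in>I. a k * \<phi> k u))" for h
  proof
    assume "degree1 l n \<kappa> h"
    then obtain c a where ca: "\<forall>u\<in>?U. h u = c + (\<Sum>j=1..n. \<Sum>i=1..l. a j i * coord_var j i u)"
      unfolding degree1_def by blast
    have "\<forall>u\<in>?U. h u =
        (\<Sum>k\<in>I. (case k of None \<Rightarrow> c | Some (j, i) \<Rightarrow> a j i) * \<phi> k u)"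
      using ca by (simp add: sumI)
    then show "\<exists>a. \<forall>u\<in>?U. h u = (\<Sum>k\<in>I. a k * \<phi> k u)" by blast
  next
    assume "\<exists>a. \<forall>u\<in>?U. h u = (\<Sum>k\<in>I. a k * \<phi> k u)"
    then obtain a where a: "\<forall>u\<in>?U. h u = (\<Sum>k\<in>I. a k * \<phi> k u)" by blast
    then show "degree1 l n \<kappa> h"
      unfolding degree1_def sumI
      by (intro exI[of _ "a None"] exI[of _ "\<lambda>j i. a (Some (j, i))"]) simp
  qed
  have "finite I" by (simp add: I_def)
  then obtain a where a: "\<forall>k\<in>I. (\<Sum>u\<in>?U. (F u - (\<Sum>i\<in>I. a i * \<phi> i u)) * \<phi> k u) = 0"
    using orthogonal_projection_exists[OF finite_multislice] by blast
  define p where "p = restrict (\<lambda>u. \<Sum>i\<in>I. a i * \<phi> i u) ?U"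
  have pex: "is_degree1_proj l n \<kappa> F p"
    unfolding is_degree1_proj_def E0
  proof (intro conjI allI impI)
    show "p \<in> extensional ?U" by (simp add: p_def)
    show "degree1 l n \<kappa> p" unfolding deg by (auto simp: p_def)
    fix h assume "degree1 l n \<kappa> h"
    then obtain b where b: "\<forall>u\<in>?U. h u = (\<Sum>k\<in>I. b k * \<phi> k u)" unfolding deg by blast
    have "(\<Sum>u\<in>?U. (F u - p u) * h u)
        = (\<Sum>u\<in>?U. \<Sum>k\<in>I. b k * ((F u - (\<Sum>i\<in>I. a i * \<phi> i u)) * \<phi> k u))"
      using b by (intro sum.cong) (auto simp: p_def sum_distrib_left mult.left_commute)
    also have "\<dots> = (\<Sum>k\<in>I. b k * (\<Sum>u\<in>?U. (F u - (\<Sum>i\<in>I. a i * \<phi> i u)) * \<phi> k u))"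
      unfolding sum_distrib_left by (rule sum.swap)
    also have "\<dots> = 0" using a by simp
    finally show "(\<Sum>u\<in>?U. (F u - p u) * h u) = 0" .
  qed
  have "q = p" if q: "is_degree1_proj l n \<kappa> F q" for q
  proof -
    from pex q obtain b c where b: "\<forall>u\<in>?U. p u = (\<Sum>k\<in>I. b k * \<phi> k u)"
      and c: "\<forall>u\<in>?U. q u = (\<Sum>k\<in>I. c k * \<phi> k u)"
      unfolding is_degree1_proj_def deg by blast
    have "\<forall>u\<in>?U. p u - q u = (\<Sum>k\<in>I. (b k - c k) * \<phi> k u)"
      using b c by (simp add: left_diff_distrib sum_subtractf)
    then have d: "degree1 l n \<kappa> (\<lambda>u. p u - q u)" unfolding deg by (intro exI[of _ "\<lambda>k. b k - c k"])
    have "(\<Sum>u\<in>?U. (F u - p u) * (p u - q u)) = 0" "(\<Sum>u\<in>?U. (F u - q u) * (p u - q u)) = 0"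
      using pex q d unfolding is_degree1_proj_def E0 by blast+
    then have "(\<Sum>u\<in>?U. (F u - q u) * (p u - q u) - (F u - p u) * (p u - q u)) = 0"
      by (simp only: sum_subtractf)
    then have "(\<Sum>u\<in>?U. (p u - q u) * (p u - q u)) = 0"
      by (simp add: algebra_simps)
    then have "\<forall>u\<in>?U. (p u - q u) * (p u - q u) = 0"
      using finite_multislice by (subst (asm) sum_nonneg_eq_0_iff) auto
    then have "\<forall>u\<in>?U. q u = p u" by auto
    moreover have "q \<in> extensional ?U" "p \<in> extensional ?U"
      using pex q by (simp_all add: is_degree1_proj_def)
    ultimately show "q = p" by (metis extensionalityI)
  qed
  with pex show ?thesis by blast
qed

end

(*
  Write a degree 1 function as f(u) = c + sum_j phi_j(u_j). Swapping coordinates j, k with colours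
  a, b changes f by gain = (phi_j(b) - phi_j(a)) - (phi_k(b) - phi_k(a)). If f is close to {0,1} in
  mean square, then a bounded number of swaps keeps some u in any prescribed pattern close to {0,1},
  so of two swaps of disjoint pairs at least one has a small gain. Hence there is one coordinate J
  such that all gains among the other coordinates are small. Swapping disjoint pairs independently at
  random turns f into a Rademacher sum with small coefficients, and such a sum has variance O(E dist^2).
  With a pairing of the coordinates around a median, this bounds the variance of f apart from u_J,
  so that f = h + q(u_J) with E h^2 = O(epsilon), and g is the rounding of q(u_J).

  The sharp constant comes from (f - g)^2 <= dist(f,{0,1})^2 + 4 (f - g)^4 together with
  E h^4 = O(epsilon^2), which follows from the method of exchangeable pairs.

  For Boolean F, the first part is applied to f = F^{<=1}, because dist(f,{0,1}) <= |f - F|.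
*)
theory Submission
  imports Defs
begin

subsection \<open>Distance to the Boolean values\<close>

definition bdist :: "real \<Rightarrow> real" where
  "bdist x = min \<bar>x\<bar> \<bar>x - 1\<bar>"

lemma infdist_bool: "infdist x {0, 1 :: real} = bdist x"
  by (simp add: infdist_def bdist_def dist_real_def cInf_eq_Min)

lemma bdist_nonneg [simp]: "0 \<le> bdist x"
  by (simp add: bdist_def)

lemma bdist_le: "y \<in> {0, 1} \<Longrightarrow> bdist x \<le> \<bar>x - y\<bar>"
  by (auto simp: bdist_def)

lemma bdist_attained: obtains y where "y \<in> {0, 1}" "bdist x = \<bar>x - y\<bar>"
  by (cases "\<bar>x\<bar> \<le> \<bar>x - 1\<bar>") (auto simp: bdist_def min_def intro: that[of 0] that[of 1])

lemma bdist_eq: "y \<in> {0, 1} \<Longrightarrow> \<bar>x - y\<bar> \<le> 1 / 2 \<Longrightarrow> bdist x = \<bar>x - y\<bar>"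
  by (auto simp: bdist_def min_def)

lemma square_add_le: "(x + y)\<^sup>2 \<le> 2 * x\<^sup>2 + 2 * (y::real)\<^sup>2"
  using zero_le_power2[of "x - y"] by (simp add: power2_eq_square algebra_simps)

lemma bdist_triangle: "(bdist x)\<^sup>2 \<le> 2 * (bdist y)\<^sup>2 + 2 * (y - x)\<^sup>2"
proof -
  have "bdist x \<le> bdist y + \<bar>y - x\<bar>"
    by (auto simp: bdist_def)
  then have "(bdist x)\<^sup>2 \<le> (bdist y + \<bar>y - x\<bar>)\<^sup>2"
    by (intro power_mono) auto
  also have "\<dots> \<le> 2 * (bdist y)\<^sup>2 + 2 * \<bar>y - x\<bar>\<^sup>2"
    by (rule square_add_le)
  finally show ?thesis by simp
qed

lemma square_le_bdist: "x\<^sup>2 \<le> 2 * (bdist x)\<^sup>2 + 2"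
proof -
  have "\<bar>x\<bar> \<le> bdist x + 1"
    by (auto simp: bdist_def)
  then have "\<bar>x\<bar>\<^sup>2 \<le> (bdist x + 1)\<^sup>2"
    by (intro power_mono) auto
  also have "\<dots> \<le> 2 * (bdist x)\<^sup>2 + 2 * 1\<^sup>2"
    by (rule square_add_le)
  finally show ?thesis by simp
qed

text \<open>Within 1/2 of \<open>y\<close>, the point \<open>y\<close> is nearest in {0,1} and the
  first term suffices; further away \<open>4 * (x - y)\<^sup>2\<close> is at least 1. Because
  \<open>(bdist x)\<^sup>2\<close> has coefficient 1, the sharp leading constant survives and
  everything else is a fourth moment.\<close>

lemma square_le_bdist_fourth:
  assumes "y \<in> {0, 1}"
  shows "(x - y)\<^sup>2 \<le> (bdist x)\<^sup>2 + 4 * (x - y) ^ 4"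
proof (cases "\<bar>x - y\<bar> \<le> 1 / 2")
  case True
  then show ?thesis
    using bdist_eq[OF assms] by simp
next
  case False
  then have "(1 / 2)\<^sup>2 \<le> \<bar>x - y\<bar>\<^sup>2"
    by (intro power_mono) auto
  then have "1 \<le> 4 * (x - y)\<^sup>2"
    by (simp add: power2_eq_square)
  then have "(x - y)\<^sup>2 * 1 \<le> (x - y)\<^sup>2 * (4 * (x - y)\<^sup>2)"
    by (intro mult_left_mono) auto
  also have "\<dots> = 4 * (x - y) ^ 4"
    by (simp add: power4_eq_xxxx power2_eq_square)
  finally show ?thesis
    by (simp add: add_increasing)
qed

subsection \<open>Rademacher sums with small coefficients\<close>

text \<open>The expectation of \<open>F\<close> at \<open>c\<close> plus the weights with
  independent uniform signs. The recursion exposes one sign at a time, to be matched with one random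
  swap.\<close>

fun rademacher_mean :: "real list \<Rightarrow> (real \<Rightarrow> real) \<Rightarrow> real \<Rightarrow> real" where
  "rademacher_mean [] F c = F c"
| "rademacher_mean (w # ws) F c = (rademacher_mean ws F (c + w) + rademacher_mean ws F (c - w)) / 2"

lemma rademacher_mean_mono: "(\<And>x. F x \<le> G x) \<Longrightarrow> rademacher_mean ws F c \<le> rademacher_mean ws G c"
  by (induction ws arbitrary: c) (auto intro: add_mono)

lemma rademacher_mean_add: "rademacher_mean ws (\<lambda>x. F x + G x) c = rademacher_mean ws F c + rademacher_mean ws G c"
  by (induction ws arbitrary: c) (auto simp: field_simps)

lemma rademacher_mean_cmult: "rademacher_mean ws (\<lambda>x. a * F x) c = a * rademacher_mean ws F c"
  by (induction ws arbitrary: c) (auto simp: field_simps)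

lemma rademacher_mean_const: "rademacher_mean ws (\<lambda>x. a) c = a"
  by (induction ws arbitrary: c) simp_all

lemma rademacher_mean_square: "rademacher_mean ws (\<lambda>x. (x - a)\<^sup>2) c = (c - a)\<^sup>2 + (\<Sum>w\<leftarrow>ws. w\<^sup>2)"
proof (induction ws arbitrary: c)
  case (Cons w ws)
  have "(c + w - a)\<^sup>2 + (c - w - a)\<^sup>2 = 2 * (c - a)\<^sup>2 + 2 * w\<^sup>2"
    by (simp add: power2_eq_square algebra_simps)
  then show ?case
    by (simp add: Cons.IH)
qed simp

text \<open>The right-hand side is the fourth moment of a Gaussian with the same mean and variance;
  a sign has fourth moment 1 instead of 3, which leaves the slack \<open>2 * w ^ 4\<close> in the
  induction.\<close>

lemma rademacher_mean_fourth:
  "rademacher_mean ws (\<lambda>x. (x - a) ^ 4) c \<le> (c - a) ^ 4 + 6 * (c - a)\<^sup>2 * (\<Sum>w\<leftarrow>ws. w\<^sup>2) + 3 * (\<Sum>w\<leftarrow>ws. w\<^sup>2)\<^sup>2"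
proof (induction ws arbitrary: c)
  case Nil
  then show ?case by simp
next
  case (Cons w ws)
  define W where "W = (\<Sum>w\<leftarrow>ws. w\<^sup>2)"
  define y where "y = c - a"
  have "rademacher_mean (w # ws) (\<lambda>x. (x - a) ^ 4) c \<le>
      (((y + w) ^ 4 + 6 * (y + w)\<^sup>2 * W + 3 * W\<^sup>2) + ((y - w) ^ 4 + 6 * (y - w)\<^sup>2 * W + 3 * W\<^sup>2)) / 2"
  proof -
    have "c + w - a = y + w" "c - w - a = y - w"
      by (simp_all add: y_def)
    then show ?thesis
      using Cons.IH[of "c + w"] Cons.IH[of "c - w"] by (simp only: W_def rademacher_mean.simps divide_right_mono)
  qed
  also have "\<dots> = y ^ 4 + 6 * y\<^sup>2 * (w\<^sup>2 + W) + 3 * (w\<^sup>2 + W)\<^sup>2 - 2 * w ^ 4"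
    by (simp add: field_simps) algebra
  also have "\<dots> \<le> y ^ 4 + 6 * y\<^sup>2 * (w\<^sup>2 + W) + 3 * (w\<^sup>2 + W)\<^sup>2"
    by simp
  finally show ?case
    by (simp add: W_def y_def)
qed

text \<open>Unless the mean is already at least 1/256, the centre \<open>c\<close> lies within 1/8
  of some \<open>y\<close> in {0,1}. Then \<open>bdist x\<close> differs from the distance to
  \<open>y\<close> only far from \<open>c\<close>, at a cost controlled by the fourth moment. This
  cost is quadratic in the variance, so a small variance absorbs it.\<close>

lemma rademacher_mean_bdist_small:
  assumes W: "(\<Sum>w\<leftarrow>ws. w\<^sup>2) \<le> 1 / 256"
  shows "(\<Sum>w\<leftarrow>ws. w\<^sup>2) \<le> 2 * rademacher_mean ws (\<lambda>x. (bdist x)\<^sup>2) c"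
proof -
  define W where "W = (\<Sum>w\<leftarrow>ws. w\<^sup>2)"
  define \<theta> where "\<theta> = rademacher_mean ws (\<lambda>x. (bdist x)\<^sup>2) c"
  have W0: "0 \<le> W"
    unfolding W_def by (rule sum_list_nonneg) auto
  have "rademacher_mean ws (\<lambda>x. (bdist c)\<^sup>2) c \<le> rademacher_mean ws (\<lambda>x. 2 * (bdist x)\<^sup>2 + 2 * (x - c)\<^sup>2) c"
    by (intro rademacher_mean_mono bdist_triangle)
  then have c1: "(bdist c)\<^sup>2 \<le> 2 * \<theta> + 2 * W"
    by (simp add: rademacher_mean_const rademacher_mean_add rademacher_mean_cmult rademacher_mean_square \<theta>_def W_def)
  show ?thesis
  proof (cases "\<theta> \<ge> 1 / 256")
    case True
    then show ?thesis
      using W by (simp add: \<theta>_def)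
  next
    case False
    then have "(bdist c)\<^sup>2 \<le> (1 / 8)\<^sup>2"
      using c1 W by (simp add: W_def power2_eq_square)
    then have c8: "bdist c \<le> 1 / 8"
      by (rule power2_le_imp_le) simp
    obtain y where y: "y \<in> {0, 1}" "bdist c = \<bar>c - y\<bar>"
      by (rule bdist_attained)
    \<comment> \<open>In the far case \<open>(x - y)\<^sup>2\<close> is at most
      \<open>16 / 9 * (x - c)\<^sup>2\<close>, and one more factor
      \<open>64 / 9 * (x - c)\<^sup>2\<close> is at least 1; the product 1024/81 is below
      13.\<close>
    have pt: "(x - y)\<^sup>2 \<le> (bdist x)\<^sup>2 + 13 * (x - c) ^ 4" for x
    proof (cases "\<bar>x - y\<bar> \<le> 1 / 2")
      case True
      then show ?thesis
        using bdist_eq[OF y(1)] by simp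
    next
      case False
      moreover have "\<bar>x - y\<bar> \<le> \<bar>x - c\<bar> + 1 / 8"
        using y(2) c8 by linarith
      ultimately have x3: "3 / 8 \<le> \<bar>x - c\<bar>"
        by linarith
      have "b \<le> a + 1 / 8 \<Longrightarrow> 3 / 8 \<le> a \<Longrightarrow> b \<le> 4 / 3 * a" for a b :: real
        by linarith
      from this[OF \<open>\<bar>x - y\<bar> \<le> \<bar>x - c\<bar> + 1 / 8\<close> x3]
      have "\<bar>x - y\<bar> \<le> 4 / 3 * \<bar>x - c\<bar>" .
      from power_mono[OF this, of 2] have "\<bar>x - y\<bar>\<^sup>2 \<le> (4 / 3 * \<bar>x - c\<bar>)\<^sup>2"
        by simp
      then have a: "(x - y)\<^sup>2 \<le> 16 / 9 * (x - c)\<^sup>2"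
        by (simp add: power_mult_distrib power2_eq_square)
      have "(3 / 8)\<^sup>2 \<le> \<bar>x - c\<bar>\<^sup>2"
        using x3 by (intro power_mono) auto
      then have "9 / 64 \<le> (x - c)\<^sup>2"
        by (simp add: power2_eq_square)
      then have "(x - c)\<^sup>2 * (9 / 64) \<le> (x - c)\<^sup>2 * (x - c)\<^sup>2"
        by (intro mult_left_mono) auto
      moreover have "(x - c)\<^sup>2 * (x - c)\<^sup>2 = (x - c) ^ 4"
        by (simp flip: power_add)
      moreover have "0 \<le> (x - c) ^ 4"
        by simp
      ultimately have "(x - y)\<^sup>2 \<le> 13 * (x - c) ^ 4"
        using a by linarith
      then show ?thesis
        by (simp add: add_increasing)
    qed
    have "rademacher_mean ws (\<lambda>x. (x - y)\<^sup>2) c \<le> rademacher_mean ws (\<lambda>x. (bdist x)\<^sup>2 + 13 * (x - c) ^ 4) c"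
      by (intro rademacher_mean_mono pt)
    also have "\<dots> \<le> \<theta> + 39 * W\<^sup>2"
      using rademacher_mean_fourth[of ws c c] by (simp add: rademacher_mean_add rademacher_mean_cmult \<theta>_def W_def)
    finally have "W \<le> \<theta> + 39 * W\<^sup>2"
      unfolding rademacher_mean_square W_def[symmetric]
      using zero_le_power2[of "c - y"] by linarith
    \<comment> \<open>The error \<open>39 * W\<^sup>2\<close> is at most
      \<open>39 / 256 * W\<close>, less than half of \<open>W\<close>.\<close>
    moreover have "W * W \<le> W * (1 / 256)"
      using W W0 by (intro mult_left_mono) (auto simp: W_def)
    ultimately have "W \<le> 2 * \<theta>"
      using W0 by (simp add: power2_eq_square)
    then show ?thesis
      by (simp add: W_def \<theta>_def)
  qed
qed

text \<open>
  A long list is reduced to a suffix of square sum between \<open>1/512\<close> and \<open>1/256\<close>, to which the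
  fourth moment argument above applies.
\<close>

lemma rademacher_mean_bdist_large:
  assumes "\<And>w. w \<in> set ws \<Longrightarrow> \<bar>w\<bar> \<le> 1 / 32" "(\<Sum>w\<leftarrow>ws. w\<^sup>2) > 1 / 512"
  shows "1 / 1024 \<le> rademacher_mean ws (\<lambda>x. (bdist x)\<^sup>2) c"
  using assms
proof (induction ws arbitrary: c)
  case Nil
  then show ?case by simp
next
  case (Cons w ws)
  show ?case
  proof (cases "(\<Sum>w\<leftarrow>w # ws. w\<^sup>2) \<le> 1 / 256")
    case True
    then show ?thesis
      using rademacher_mean_bdist_small[OF True, of c] Cons.prems(2) by linarith
  next
    case False
    \<comment> \<open>Dropping the head costs at most 1/1024 of a square sum above 1/256, so the
      tail still exceeds 1/512.\<close>
    have "\<bar>w\<bar> \<le> 1 / 32"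
      using Cons.prems(1) by simp
    then have "\<bar>w\<bar>\<^sup>2 \<le> (1 / 32)\<^sup>2"
      by (intro power_mono) auto
    then have "w\<^sup>2 \<le> 1 / 1024"
      by (simp add: power2_eq_square)
    then have "(\<Sum>w\<leftarrow>ws. w\<^sup>2) > 1 / 512"
      using False by simp
    then have "1 / 1024 \<le> rademacher_mean ws (\<lambda>x. (bdist x)\<^sup>2) c" for c
      using Cons.IH Cons.prems(1) by auto
    from this[of "c + w"] this[of "c - w"] show ?thesis
      by simp
  qed
qed

lemma rademacher_mean_bdist:
  assumes "\<And>w. w \<in> set ws \<Longrightarrow> \<bar>w\<bar> \<le> 1 / 32"
  shows "(\<Sum>w\<leftarrow>ws. w\<^sup>2) \<le> 2050 * rademacher_mean ws (\<lambda>x. (bdist x)\<^sup>2) c"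
proof (cases "(\<Sum>w\<leftarrow>ws. w\<^sup>2) \<le> 1 / 256")
  case True
  moreover have "0 \<le> rademacher_mean ws (\<lambda>x. (bdist x)\<^sup>2) c"
    using rademacher_mean_mono[of "\<lambda>_. 0" "\<lambda>x. (bdist x)\<^sup>2" ws c] by (simp add: rademacher_mean_const)
  ultimately show ?thesis
    using rademacher_mean_bdist_small[OF True, of c] by linarith
next
  case False
  then have big: "1 / 1024 \<le> rademacher_mean ws (\<lambda>x. (bdist x)\<^sup>2) c"
    using assms by (intro rademacher_mean_bdist_large) auto
  \<comment> \<open>Here the variance is at most twice the mean plus 2, and 2 is at most 2048 times
    the mean by \<open>big\<close>; hence 2050.\<close>
  have "rademacher_mean ws (\<lambda>x. (x - 0)\<^sup>2) c \<le> rademacher_mean ws (\<lambda>x. 2 * (bdist x)\<^sup>2 + 2) c"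
    by (intro rademacher_mean_mono) (use square_le_bdist in simp)
  then have "c\<^sup>2 + (\<Sum>w\<leftarrow>ws. w\<^sup>2) \<le> 2 * rademacher_mean ws (\<lambda>x. (bdist x)\<^sup>2) c + 2"
    unfolding rademacher_mean_square rademacher_mean_add rademacher_mean_cmult rademacher_mean_const by simp
  then show ?thesis
    using big zero_le_power2[of c] by linarith
qed

text \<open>
  The point \<open>m\<close> is a median: pairing the smallest value with the largest one, and so on inwards,
  puts the two values of each pair on opposite sides of \<open>m\<close>.
\<close>

lemma median_pairing:
  fixes d :: "'a \<Rightarrow> real"
  assumes "finite T"
  shows "\<exists>m ps. distinct (concat (map (\<lambda>(j, k). [j, k]) ps)) \<and>
    set (concat (map (\<lambda>(j, k). [j, k]) ps)) \<subseteq> T \<and>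
    (T \<noteq> {} \<longrightarrow> (\<exists>x\<in>T. d x \<le> m) \<and> (\<exists>y\<in>T. m \<le> d y)) \<and>
    (\<Sum>j\<in>T. (d j - m)\<^sup>2) \<le> (\<Sum>(j, k)\<leftarrow>ps. (d j - d k)\<^sup>2)"
  using assms
proof (induction T rule: finite_psubset_induct)
  case (psubset T)
  show ?case
  proof (cases "T = {}")
    case True
    then show ?thesis
      by (intro exI[of _ 0] exI[of _ "[]"]) auto
  next
    case False
    obtain x where x: "x \<in> T" "\<And>z. z \<in> T \<Longrightarrow> d x \<le> d z"
      using ex_is_arg_min_if_finite[OF psubset.hyps False, of d]
      by (auto simp: is_arg_min_linorder)
    obtain y where y: "y \<in> T" "\<And>z. z \<in> T \<Longrightarrow> d z \<le> d y"
      using ex_is_arg_min_if_finite[OF psubset.hyps False, of "\<lambda>z. - d z"]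
      by (auto simp: is_arg_min_linorder)
    show ?thesis
    proof (cases "x = y")
      case True
      have "d z = d x" if "z \<in> T" for z
        using x(2)[OF that] y(2)[OF that] True by simp
      then have "(\<Sum>j\<in>T. (d j - d x)\<^sup>2) = 0"
        by (intro sum.neutral) simp
      then show ?thesis
        using x(1) by (intro exI[of _ "d x"] exI[of _ "[]"]) (simp add: bexI[of _ x])
    next
      case xy: False
      define T' where "T' = T - {x, y}"
      have "T' \<subset> T"
        using x(1) by (auto simp: T'_def)
      from psubset.IH[OF this] obtain m' ps where
        ps: "distinct (concat (map (\<lambda>(j, k). [j, k]) ps))"
        "set (concat (map (\<lambda>(j, k). [j, k]) ps)) \<subseteq> T'"
        and m': "T' \<noteq> {} \<longrightarrow> (\<exists>x\<in>T'. d x \<le> m') \<and> (\<exists>y\<in>T'. m' \<le> d y)"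
        and le: "(\<Sum>j\<in>T'. (d j - m')\<^sup>2) \<le> (\<Sum>(j, k)\<leftarrow>ps. (d j - d k)\<^sup>2)"
        by blast
      \<comment> \<open>For empty \<open>T'\<close> the induction hypothesis does not place
        \<open>m'\<close> between \<open>d x\<close> and \<open>d y\<close>, so a value in that
        range is chosen by hand.\<close>
      define m where "m = (if T' = {} then d x else m')"
      have "d x \<le> m"
      proof (cases "T' = {}")
        case False
        then obtain z where "z \<in> T'" "d z \<le> m'"
          using m' by blast
        then show ?thesis
          using False x(2)[of z] by (simp add: m_def T'_def)
      qed (simp add: m_def)
      moreover have "m \<le> d y"
      proof (cases "T' = {}")
        case False
        then obtain z where "z \<in> T'" "m' \<le> d z"
          using m' by blast
        then show ?thesis
          using False y(2)[of z] by (simp add: m_def T'_def)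
      qed (simp add: m_def x(2) y(1))
      ultimately have "0 \<le> (m - d x) * (d y - m)"
        by simp
      then have "(d x - m)\<^sup>2 + (d y - m)\<^sup>2 \<le> (d x - d y)\<^sup>2"
        by (simp add: power2_eq_square algebra_simps)
      moreover have "(\<Sum>j\<in>T'. (d j - m)\<^sup>2) \<le> (\<Sum>(j, k)\<leftarrow>ps. (d j - d k)\<^sup>2)"
        using le by (cases "T' = {}") (auto simp: m_def)
      moreover have "(\<Sum>j\<in>T. (d j - m)\<^sup>2) = (d x - m)\<^sup>2 + (d y - m)\<^sup>2 + (\<Sum>j\<in>T'. (d j - m)\<^sup>2)"
      proof -
        have T: "T = insert x (insert y T')" and "finite T'" "x \<notin> T'" "y \<notin> T'"
          using x y psubset.hyps by (auto simp: T'_def)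
        then show ?thesis
          unfolding T using xy by simp
      qed
      ultimately have "(\<Sum>j\<in>T. (d j - m)\<^sup>2) \<le> (\<Sum>(j, k)\<leftarrow>(x, y) # ps. (d j - d k)\<^sup>2)"
        by simp
      moreover have "distinct (concat (map (\<lambda>(j, k). [j, k]) ((x, y) # ps)))"
        "set (concat (map (\<lambda>(j, k). [j, k]) ((x, y) # ps))) \<subseteq> T"
        using ps xy x(1) y(1) by (auto simp: T'_def)
      ultimately show ?thesis
        using \<open>d x \<le> m\<close> \<open>m \<le> d y\<close> x(1) y(1) by blast
    qed
  qed
qed

subsection \<open>Exchanging coordinates\<close>

definition exch :: "'a \<Rightarrow> 'a \<Rightarrow> ('a \<Rightarrow> 'b) \<Rightarrow> 'a \<Rightarrow> 'b" where
  "exch j k u = u(j := u k, k := u j)"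

lemma exch_exch [simp]: "exch j k (exch j k u) = u"
  by (auto simp: exch_def fun_eq_iff)

lemma exch_apply: "exch j k u i = u (if i = j then k else if i = k then j else i)"
  by (auto simp: exch_def)

lemma exch_multislice:
  assumes "u \<in> multislice l n \<kappa>" "j \<in> {1..n}" "k \<in> {1..n}"
  shows "exch j k u \<in> multislice l n \<kappa>"
proof -
  let ?\<tau> = "\<lambda>i. if i = j then k else if i = k then j else i"
  have "card {i \<in> {1..n}. exch j k u i = c} = card {i \<in> {1..n}. u i = c}" for c
  proof (rule bij_betw_same_card[of ?\<tau>], rule bij_betw_byWitness[where f' = ?\<tau>])
    show "?\<tau> ` {i \<in> {1..n}. exch j k u i = c} \<subseteq> {i \<in> {1..n}. u i = c}"
      "?\<tau> ` {i \<in> {1..n}. u i = c} \<subseteq> {i \<in> {1..n}. exch j k u i = c}"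
      using assms(2,3) by (auto simp: exch_apply split: if_splits)
  qed auto
  moreover have "exch j k u \<in> {1..n} \<rightarrow>\<^sub>E {1..l}"
    using assms by (auto simp: multislice_def exch_def PiE_def Pi_def extensional_def)
  ultimately show ?thesis
    using assms(1) by (simp add: multislice_def)
qed

lemma sum_exch:
  assumes "j \<in> {1..n}" "k \<in> {1..n}"
  shows "(\<Sum>u\<in>multislice l n \<kappa>. g (exch j k u)) = (\<Sum>u\<in>multislice l n \<kappa>. g u)"
  by (rule sum.reindex_bij_witness[of _ "exch j k" "exch j k"])
    (auto intro: exch_multislice assms)

definition lin :: "nat \<Rightarrow> real \<Rightarrow> (nat \<Rightarrow> 'b \<Rightarrow> real) \<Rightarrow> (nat \<Rightarrow> 'b) \<Rightarrow> real" where
  "lin n c \<phi> u = c + (\<Sum>j=1..n. \<phi> j (u j))"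

definition gain :: "('a \<Rightarrow> 'b \<Rightarrow> real) \<Rightarrow> 'a \<Rightarrow> 'a \<Rightarrow> 'b \<Rightarrow> 'b \<Rightarrow> real" where
  "gain \<phi> j k a b = (\<phi> j b - \<phi> j a) - (\<phi> k b - \<phi> k a)"

lemma gain_commute: "gain \<phi> k j a b = - gain \<phi> j k a b"
  by (simp add: gain_def)

lemma gain_trans: "gain \<phi> j k a b = gain \<phi> j p a b - gain \<phi> k p a b"
  by (simp add: gain_def)

lemma lin_exch:
  assumes "j \<in> {1..n}" "k \<in> {1..n}"
  shows "lin n c \<phi> (exch j k u) = lin n c \<phi> u + gain \<phi> j k (u j) (u k)"
proof (cases "j = k")
  case True
  then show ?thesis
    by (simp add: exch_def gain_def)
next
  case False
  have "(\<Sum>i=1..n. \<phi> i (exch j k u i)) - (\<Sum>i=1..n. \<phi> i (u i)) =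
      (\<Sum>i=1..n. \<phi> i (exch j k u i) - \<phi> i (u i))"
    by (simp add: sum_subtractf)
  also have "\<dots> = (\<Sum>i\<in>{j, k}. \<phi> i (exch j k u i) - \<phi> i (u i))"
    using assms by (intro sum.mono_neutral_right) (auto simp: exch_def)
  also have "\<dots> = gain \<phi> j k (u j) (u k)"
    using False by (simp add: exch_def gain_def)
  finally show ?thesis
    by (simp add: lin_def)
qed

text \<open>
  Swapping disjoint pairs of coordinates independently with probability \<open>1/2\<close> preserves the uniform
  measure and turns a degree 1 function into a Rademacher sum.
\<close>

lemma sum_rademacher_mean_exch:
  assumes "distinct (concat (map (\<lambda>(j, k). [j, k]) ps))"
    "set (concat (map (\<lambda>(j, k). [j, k]) ps)) \<subseteq> {1..n}"
  shows "(\<Sum>u\<in>multislice l n \<kappa>. rademacher_mean (map (\<lambda>(j, k). gain \<phi> j k (u j) (u k) / 2) ps) F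
      (lin n c \<phi> u + (\<Sum>(j, k)\<leftarrow>ps. gain \<phi> j k (u j) (u k) / 2))) =
    (\<Sum>u\<in>multislice l n \<kappa>. F (lin n c \<phi> u))"
  using assms
proof (induction ps)
  case Nil
  then show ?case by simp
next
  case (Cons p ps)
  obtain j k where p: "p = (j, k)"
    by fastforce
  define ws where "ws u = map (\<lambda>(j, k). gain \<phi> j k (u j) (u k) / 2) ps" for u :: "nat \<Rightarrow> nat"
  define R where "R u = rademacher_mean (ws u) F (lin n c \<phi> u + sum_list (ws u))" for u
  have jk: "j \<in> {1..n}" "k \<in> {1..n}"
    using Cons.prems by (simp_all add: p)
  have new: "fst q \<noteq> j \<and> fst q \<noteq> k \<and> snd q \<noteq> j \<and> snd q \<noteq> k" if "q \<in> set ps" for q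
  proof -
    have "{fst q, snd q} \<subseteq> set (concat (map (\<lambda>(j, k). [j, k]) ps))"
      using that by (auto simp: case_prod_unfold)
    moreover have "{j, k} \<inter> set (concat (map (\<lambda>(j, k). [j, k]) ps)) = {}"
      using Cons.prems(1) by (simp add: p)
    ultimately show ?thesis
      by blast
  qed
  have ws: "ws (exch j k u) = ws u" for u
    unfolding ws_def by (intro map_cong refl) (use new in \<open>auto simp: exch_def\<close>)
  \<comment> \<open>Centring at half of the gains makes the plus sign mean that \<open>j\<close> and
    \<open>k\<close> are swapped and the minus sign that they are not. The other pairs avoid
    \<open>j\<close> and \<open>k\<close>, so their weights are the same in both cases.\<close>
  have "rademacher_mean (map (\<lambda>(j, k). gain \<phi> j k (u j) (u k) / 2) (p # ps)) F
      (lin n c \<phi> u + (\<Sum>(j, k)\<leftarrow>p # ps. gain \<phi> j k (u j) (u k) / 2)) =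
      (R (exch j k u) + R u) / 2" for u
    unfolding R_def ws lin_exch[OF jk] by (simp add: p algebra_simps flip: ws_def)
  then have "(\<Sum>u\<in>multislice l n \<kappa>. rademacher_mean (map (\<lambda>(j, k). gain \<phi> j k (u j) (u k) / 2) (p # ps)) F
      (lin n c \<phi> u + (\<Sum>(j, k)\<leftarrow>p # ps. gain \<phi> j k (u j) (u k) / 2))) =
      ((\<Sum>u\<in>multislice l n \<kappa>. R (exch j k u)) + (\<Sum>u\<in>multislice l n \<kappa>. R u)) / 2"
    by (simp only: sum.distrib flip: sum_divide_distrib)
  also have "\<dots> = (\<Sum>u\<in>multislice l n \<kappa>. R u)"
    by (simp add: sum_exch[OF jk])
  also have "\<dots> = (\<Sum>u\<in>multislice l n \<kappa>. F (lin n c \<phi> u))"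
    unfolding R_def ws_def using Cons.prems by (intro Cons.IH) auto
  finally show ?case .
qed

text \<open>
  Pairs with \<open>\<bar>D j k x\<bar> > \<eta>\<close> for some \<open>x\<close> are the edges of a graph without two disjoint edges, that is,
  a star or a triangle; the triangle is harmless by the triangle inequality through a further vertex,
  which costs the factor 2.
\<close>

lemma star_or_small:
  fixes D :: "nat \<Rightarrow> nat \<Rightarrow> 'c \<Rightarrow> real"
  assumes n: "n \<ge> 5"
    and sym: "\<And>j k x. \<bar>D k j x\<bar> = \<bar>D j k x\<bar>"
    and tri: "\<And>j k p x. \<bar>D j k x\<bar> \<le> \<bar>D j p x\<bar> + \<bar>D k p x\<bar>"
    and disj: "\<And>j k j' k' x x'. \<lbrakk>distinct [j, k, j', k']; {j, k, j', k'} \<subseteq> {1..n}; x \<in> X; x' \<in> X\<rbrakk>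
      \<Longrightarrow> \<bar>D j k x\<bar> \<le> \<eta> \<or> \<bar>D j' k' x'\<bar> \<le> \<eta>"
    and \<eta>: "\<eta> \<ge> 0"
  shows "\<exists>J\<in>{1..n}. \<forall>j\<in>{1..n} - {J}. \<forall>k\<in>{1..n} - {J}. j \<noteq> k \<longrightarrow> (\<forall>x\<in>X. \<bar>D j k x\<bar> \<le> 2 * \<eta>)"
proof (rule ccontr)
  define bad where "bad j k \<longleftrightarrow> (\<exists>x\<in>X. \<bar>D j k x\<bar> > \<eta>)" for j k
  have bad_sym: "bad k j \<longleftrightarrow> bad j k" for j k
    using sym by (simp add: bad_def)
  have bad_disj: "\<not> (bad j k \<and> bad j' k')"
    if "distinct [j, k, j', k']" "{j, k, j', k'} \<subseteq> {1..n}" for j k j' k'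
    using disj[OF that] unfolding bad_def by (meson not_less)
  assume neg: "\<not> ?thesis"
  have ex: "\<exists>j k x. j \<in> {1..n} - {J} \<and> k \<in> {1..n} - {J} \<and> j \<noteq> k \<and> x \<in> X \<and> \<bar>D j k x\<bar> > 2 * \<eta>"
    if "J \<in> {1..n}" for J
    unfolding not_le[symmetric] using neg that by blast
  obtain j k x where jk: "j \<in> {1..n}" "k \<in> {1..n}" "j \<noteq> k" "x \<in> X" and big: "\<bar>D j k x\<bar> > 2 * \<eta>"
    using ex[of 1] n by auto
  have jk_bad: "bad j k"
    unfolding bad_def using jk big \<eta> by (intro bexI[of _ x]) auto
  \<comment> \<open>Removing the endpoint \<open>a\<close> must leave a bad edge. It meets the bad
    edge between \<open>j\<close> and \<open>k\<close>, hence contains \<open>b\<close>.\<close>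
  have edge: "\<exists>m\<in>{1..n} - {j, k}. bad b m"
    if ab: "(a, b) = (j, k) \<or> (a, b) = (k, j)" for a b
  proof -
    have "a \<in> {1..n}"
      using ab jk by auto
    from ex[OF this] obtain p q y where pq: "p \<in> {1..n} - {a}" "q \<in> {1..n} - {a}" "p \<noteq> q" "y \<in> X"
      "\<bar>D p q y\<bar> > 2 * \<eta>" by blast
    then have "bad p q"
      unfolding bad_def using \<eta> by (intro bexI[of _ y]) auto
    moreover have "p = b \<or> q = b"
      using bad_disj[of j k p q] jk_bad \<open>bad p q\<close> ab jk pq by auto
    ultimately show ?thesis
      using pq ab bad_sym[of p q] by auto
  qed
  obtain m where m: "m \<in> {1..n} - {j, k}" "bad k m"
    using edge[of j k] by blast
  obtain m' where m': "m' \<in> {1..n} - {j, k}" "bad j m'"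
    using edge[of k j] by blast
  \<comment> \<open>Otherwise the bad edges from \<open>k\<close> to \<open>m\<close> and from
    \<open>j\<close> to \<open>m'\<close> are disjoint. So \<open>j\<close>, \<open>k\<close>,
    \<open>m\<close> form a triangle, and an edge from \<open>j\<close> or \<open>k\<close> to a
    fourth vertex \<open>p\<close> is disjoint from one of its sides.\<close>
  have [simp]: "m' = m"
    using bad_disj[of k m j m'] m m' jk by auto
  have "card ({1..n} - {j, k, m}) > 0"
    using card_Diff_subset[of "{j, k, m}" "{1..n}"] m jk n by (simp add: card_insert_if)
  then obtain p where p: "p \<in> {1..n}" "p \<notin> {j, k, m}"
    by (metis Diff_iff card_gt_0_iff ex_in_conv)
  have "\<not> bad j p" "\<not> bad k p"
    using bad_disj[of j p k m] bad_disj[of k p j m] m m' jk p by auto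
  then have "\<bar>D j p x\<bar> \<le> \<eta>" "\<bar>D k p x\<bar> \<le> \<eta>"
    using jk by (auto simp: bad_def not_less)
  then show False
    using tri[of j k x p] big by linarith
qed

section \<open>Frequencies of colour patterns\<close>

locale balanced_multislice =
  fixes l n :: nat and \<kappa> :: "nat \<Rightarrow> nat" and \<rho> :: real
  assumes l: "l \<ge> 2" and \<rho>: "\<rho> > 0" and n: "n \<ge> 5" "6 \<le> \<rho> * real n"
    and \<kappa>: "\<And>i. i \<in> {1..l} \<Longrightarrow> \<rho> * real n \<le> real (\<kappa> i)" and sum_\<kappa>: "(\<Sum>i=1..l. \<kappa> i) = n"
begin

abbreviation "U \<equiv> multislice l n \<kappa>"

text \<open>
  By symmetry, all coordinates outside \<open>A\<close> have colour \<open>i\<close> equally often in \<open>P\<close>.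
\<close>

lemma card_pattern_step:
  assumes P: "P \<subseteq> U" "\<And>u k k'. \<lbrakk>u \<in> P; k \<in> {1..n} - A; k' \<in> {1..n} - A\<rbrakk> \<Longrightarrow> exch k k' u \<in> P"
    and A: "finite A" "card A \<le> 3" and j: "j \<in> {1..n} - A" and i: "i \<in> {1..l}"
  shows "\<rho> / 2 * real (card P) \<le> real (card {u \<in> P. u j = i})"
proof -
  have fin: "finite P"
    using P(1) finite_multislice finite_subset by blast
  have "\<kappa> i - 3 \<le> card {k \<in> {1..n} - A. u k = i}" if "u \<in> P" for u
  proof -
    have "u \<in> U"
      using that P(1) by blast
    then have "card {k \<in> {1..n}. u k = i} = \<kappa> i"
      using i by (simp add: multislice_def)
    moreover have "card {k \<in> {1..n}. u k = i} - card A \<le> card ({k \<in> {1..n}. u k = i} - A)"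
      using A(1) by (rule diff_card_le_card_Diff)
    moreover have "{k \<in> {1..n}. u k = i} - A = {k \<in> {1..n} - A. u k = i}"
      by auto
    ultimately have "\<kappa> i - card A \<le> card {k \<in> {1..n} - A. u k = i}"
      by (simp only:)
    then show ?thesis
      using A(2) by linarith
  qed
  \<comment> \<open>Double counting of the pairs of a word \<open>u\<close> in \<open>P\<close> and
    a coordinate outside \<open>A\<close> with colour \<open>i\<close>.\<close>
  then have "card P * (\<kappa> i - 3) \<le> (\<Sum>u\<in>P. card {k \<in> {1..n} - A. u k = i})"
    using sum_mono[of P "\<lambda>_. \<kappa> i - 3" "\<lambda>u. card {k \<in> {1..n} - A. u k = i}"] by simp
  also have "\<dots> = (\<Sum>k\<in>{1..n} - A. card {u \<in> P. u k = i})"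
    by (rule sum_multicount_gen) (use fin in auto)
  also have "\<dots> = (\<Sum>k\<in>{1..n} - A. card {u \<in> P. u j = i})"
  proof (intro sum.cong refl)
    fix k assume k: "k \<in> {1..n} - A"
    show "card {u \<in> P. u k = i} = card {u \<in> P. u j = i}"
      by (rule bij_betw_same_card[of "exch j k"], rule bij_betw_byWitness[where f' = "exch j k"])
        (use P(2) j k in \<open>auto simp: exch_apply\<close>)
  qed
  also have "\<dots> \<le> n * card {u \<in> P. u j = i}"
    using card_mono[of "{1..n}" "{1..n} - A"] by (simp del: card_Diff_insert)
  finally have "real (card P) * real (\<kappa> i - 3) \<le> real n * real (card {u \<in> P. u j = i})"
    unfolding of_nat_mult[symmetric] of_nat_le_iff .
  \<comment> \<open>Losing three coordinates costs at most half of \<open>\<rho> * real n\<close>,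
    because this number is at least 6.\<close>
  moreover have "\<rho> * real n / 2 \<le> real (\<kappa> i - 3)"
    using \<kappa>[OF i] n(2) by linarith
  then have "real (card P) * (\<rho> * real n / 2) \<le> real (card P) * real (\<kappa> i - 3)"
    by (intro mult_left_mono) auto
  ultimately have "real n * (\<rho> / 2 * real (card P)) \<le> real n * real (card {u \<in> P. u j = i})"
    by (simp add: algebra_simps)
  then show ?thesis
    using n by simp
qed

lemma card_pattern1:
  assumes "j \<in> {1..n}" "a \<in> {1..l}"
  shows "\<rho> / 2 * real (card U) \<le> real (card {u \<in> U. u j = a})"
  by (rule card_pattern_step[of _ "{}"]) (use assms exch_multislice in auto)

lemma card_pattern2:
  assumes "distinct [j, k]" "{j, k} \<subseteq> {1..n}" "{a, b} \<subseteq> {1..l}"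
  shows "(\<rho> / 2)\<^sup>2 * real (card U) \<le> real (card {u \<in> U. u j = a \<and> u k = b})"
proof -
  let ?P = "{u \<in> U. u j = a}"
  have "\<rho> / 2 * (\<rho> / 2 * real (card U)) \<le> \<rho> / 2 * real (card ?P)"
    using assms \<rho> by (intro mult_left_mono card_pattern1) auto
  also have "\<dots> \<le> real (card {u \<in> ?P. u k = b})"
    by (rule card_pattern_step[of _ "{j}"]) (use assms exch_multislice in \<open>auto simp: exch_apply\<close>)
  also have "{u \<in> ?P. u k = b} = {u \<in> U. u j = a \<and> u k = b}"
    by auto
  finally show ?thesis
    by (simp add: power2_eq_square mult.assoc)
qed

text \<open>The colours are prescribed one coordinate after another at a factor
  \<open>\<rho> / 2\<close> each. The words with the pattern so far are closed under swaps of the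
  untouched coordinates, as \<open>card_pattern_step\<close> requires.\<close>

lemma card_pattern4:
  assumes "distinct [j, k, j', k']" "{j, k, j', k'} \<subseteq> {1..n}" "{a, b, a', b'} \<subseteq> {1..l}"
  shows "(\<rho> / 2) ^ 4 * real (card U) \<le> real (card {u \<in> U. u j = a \<and> u k = b \<and> u j' = a' \<and> u k' = b'})"
proof -
  let ?P = "{u \<in> U. u j = a \<and> u k = b}" and ?Q = "{u \<in> U. u j = a \<and> u k = b \<and> u j' = a'}"
  have "\<rho> / 2 * (\<rho> / 2 * ((\<rho> / 2)\<^sup>2 * real (card U))) \<le> \<rho> / 2 * (\<rho> / 2 * real (card ?P))"
    using assms \<rho> by (intro mult_left_mono card_pattern2) auto
  also have "\<rho> / 2 * real (card ?P) \<le> real (card {u \<in> ?P. u j' = a'})"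
    by (rule card_pattern_step[of _ "{j, k}"])
      (use assms exch_multislice in \<open>auto simp: exch_apply card_insert_if\<close>)
  also have "{u \<in> ?P. u j' = a'} = ?Q"
    by auto
  also have "\<rho> / 2 * real (card ?Q) \<le> real (card {u \<in> ?Q. u k' = b'})"
    by (rule card_pattern_step[of _ "{j, k, j'}"])
      (use assms exch_multislice in \<open>auto simp: exch_apply card_insert_if\<close>)
  also have "{u \<in> ?Q. u k' = b'} = {u \<in> U. u j = a \<and> u k = b \<and> u j' = a' \<and> u k' = b'}"
    by auto
  finally show ?thesis
    using \<rho> by (simp add: power2_eq_square power4_eq_xxxx mult.assoc)
qed

end

text \<open>Induction on the number of colours: the last colour is given to any subset of the right
  size. The coordinate set is generalised to a finite set \<open>A\<close>, since what remains is no
  longer an initial segment.\<close>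

lemma multislice_nonempty: "multislice l (\<Sum>i=1..l. \<kappa> i) \<kappa> \<noteq> {}"
proof -
  have "\<exists>u\<in>A \<rightarrow>\<^sub>E {1..l}. \<forall>i\<in>{1..l}. card {j \<in> A. u j = i} = \<kappa> i"
    if "finite A" "card A = (\<Sum>i=1..l. \<kappa> i)" for A :: "nat set"
    using that
  proof (induction l arbitrary: A)
    case 0
    then show ?case by simp
  next
    case (Suc l)
    then have "\<kappa> (Suc l) \<le> card A"
      by simp
    then obtain B where B: "B \<subseteq> A" "card B = \<kappa> (Suc l)"
      by (rule obtain_subset_with_card_n)
    then have "card (A - B) = (\<Sum>i=1..l. \<kappa> i)"
      using Suc.prems by (simp add: card_Diff_subset finite_subset)
    then obtain u where u: "u \<in> (A - B) \<rightarrow>\<^sub>E {1..l}"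
      "\<And>i. i \<in> {1..l} \<Longrightarrow> card {j \<in> A - B. u j = i} = \<kappa> i"
      using Suc.IH[of "A - B"] Suc.prems(1) by blast
    define v where "v j = (if j \<in> B then Suc l else u j)" for j
    have "v \<in> A \<rightarrow>\<^sub>E {1..Suc l}"
    proof (rule PiE_I)
      fix j assume "j \<in> A"
      then show "v j \<in> {1..Suc l}"
        using PiE_mem[OF u(1), of j] by (auto simp: v_def)
    next
      fix j assume "j \<notin> A"
      then show "v j = undefined"
        using PiE_arb[OF u(1), of j] B by (auto simp: v_def)
    qed
    moreover have "card {j \<in> A. v j = i} = \<kappa> i" if "i \<in> {1..Suc l}" for i
    proof (cases "i = Suc l")
      case True
      have "u j \<noteq> Suc l" if "j \<in> A - B" for j
        using PiE_mem[OF u(1) that] by auto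
      then have "{j \<in> A. v j = i} = B"
        using B True by (auto simp: v_def)
      then show ?thesis
        using B True by simp
    next
      case False
      then have "{j \<in> A. v j = i} = {j \<in> A - B. u j = i}"
        by (auto simp: v_def)
      then show ?thesis
        using u(2)[of i] False that by auto
    qed
    ultimately show ?case
      by blast
  qed
  from this[of "{1..\<Sum>i=1..l. \<kappa> i}"] show ?thesis
    by (auto simp: multislice_def)
qed

text \<open>If neither shift is small, each must move \<open>x\<close> from near one Boolean value
  to near the other, so both are close to the same number 1 or -1. Performing both then overshoots
  to about 2 or -1.\<close>

lemma bdist_parallelogram:
  assumes "bdist x \<le> 1 / 64" "bdist (x + s) \<le> 1 / 64" "bdist (x + t) \<le> 1 / 64" "bdist (x + s + t) \<le> 1 / 64"
  shows "\<bar>s\<bar> \<le> 1 / 32 \<or> \<bar>t\<bar> \<le> 1 / 32"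
proof -
  have r: "\<bar>z\<bar> \<le> 1 / 64 \<or> \<bar>z - 1\<bar> \<le> 1 / 64" if "bdist z \<le> 1 / 64" for z
    using that by (auto simp: bdist_def)
  show ?thesis
    using r[OF assms(1)] r[OF assms(2)] r[OF assms(3)] r[OF assms(4)]
    by (elim disjE) linarith+
qed

text \<open>The mean minimises the sum of squared deviations. This allows replacing the median by
  the mean, for which the deviations sum to zero.\<close>

lemma sum_square_mean_le:
  fixes x :: "'a \<Rightarrow> real"
  assumes "finite T" "T \<noteq> {}"
  shows "(\<Sum>j\<in>T. (x j - (\<Sum>i\<in>T. x i) / card T)\<^sup>2) \<le> (\<Sum>j\<in>T. (x j - m)\<^sup>2)"
proof -
  define \<mu> where "\<mu> = (\<Sum>i\<in>T. x i) / card T"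
  have "card T \<noteq> 0"
    using assms by simp
  then have 0: "(\<Sum>j\<in>T. x j - \<mu>) = 0"
    by (simp add: sum_subtractf \<mu>_def)
  have "(\<Sum>j\<in>T. (x j - m)\<^sup>2) = (\<Sum>j\<in>T. (x j - \<mu>)\<^sup>2 + 2 * (\<mu> - m) * (x j - \<mu>) + (\<mu> - m)\<^sup>2)"
    by (intro sum.cong refl) (simp add: power2_eq_square algebra_simps)
  also have "\<dots> = (\<Sum>j\<in>T. (x j - \<mu>)\<^sup>2) + 2 * (\<mu> - m) * (\<Sum>j\<in>T. x j - \<mu>) + card T * (\<mu> - m)\<^sup>2"
    by (simp only: sum.distrib sum_distrib_left sum_constant)
  finally show ?thesis
    using 0 by (simp flip: \<mu>_def)
qed

lemma multislice_coord: "u \<in> multislice l n \<kappa> \<Longrightarrow> j \<in> {1..n} \<Longrightarrow> u j \<in> {1..l}"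
  by (auto simp: multislice_def)

text \<open>The right-hand side does not depend on \<open>u\<close>: a term that treats all
  coordinates alike is constant on the multislice and can be moved into the constant of a linear
  statistic.\<close>

lemma sum_colours:
  assumes "u \<in> multislice l n \<kappa>"
  shows "(\<Sum>j=1..n. \<mu> (u j)) = (\<Sum>i=1..l. real (\<kappa> i) * \<mu> i)"
proof -
  have "(\<Sum>j=1..n. \<mu> (u j)) = (\<Sum>i=1..l. \<Sum>j\<in>{j \<in> {1..n}. u j = i}. \<mu> (u j))"
    by (rule sum.group[symmetric]) (use multislice_coord[OF assms] in auto)
  also have "\<dots> = (\<Sum>i=1..l. real (\<kappa> i) * \<mu> i)"
    using assms by (intro sum.cong) (auto simp: multislice_def)
  finally show ?thesis .
qed

subsection \<open>Moments of centred linear statistics\<close>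

text \<open>
  Stein's method of exchangeable pairs: a centred linear statistic \<open>h\<close> is an eigenfunction of
  the random transposition walk, so \<open>E[h * \<psi>(h)]\<close> is controlled by the increments of \<open>h\<close> along
  one step of the walk.
\<close>

lemma exchangeable_pairs:
  assumes e: "\<And>i. i \<in> {1..l} \<Longrightarrow> (\<Sum>j=1..n. e j i) = 0"
  defines "h \<equiv> lin n 0 e"
  shows "4 * real n * (\<Sum>u\<in>multislice l n \<kappa>. h u * \<psi> (h u)) =
    (\<Sum>j=1..n. \<Sum>k=1..n. \<Sum>u\<in>multislice l n \<kappa>.
      (h (exch j k u) - h u) * (\<psi> (h (exch j k u)) - \<psi> (h u)))"
proof -
  let ?U = "multislice l n \<kappa>"
  \<comment> \<open>Of the four double sums of the gain, the two mixed ones vanish because each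
    column of \<open>e\<close> sums to zero; the other two give \<open>- real n * h u\<close>
    each.\<close>
  have eig: "(\<Sum>j=1..n. \<Sum>k=1..n. h (exch j k u) - h u) = - 2 * real n * h u" if u: "u \<in> ?U" for u
  proof -
    have "(\<Sum>j=1..n. \<Sum>k=1..n. h (exch j k u) - h u) =
        (\<Sum>j=1..n. \<Sum>k=1..n. e j (u k)) - (\<Sum>j=1..n. \<Sum>k=1..n. e j (u j))
        - (\<Sum>j=1..n. \<Sum>k=1..n. e k (u k)) + (\<Sum>j=1..n. \<Sum>k=1..n. e k (u j))"
      by (simp add: h_def lin_exch gain_def sum.distrib sum_subtractf)
    moreover have "(\<Sum>j=1..n. \<Sum>k=1..n. e k (u j)) = 0"
      using multislice_coord[OF u] by (intro sum.neutral ballI e)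
    moreover have "(\<Sum>j=1..n. \<Sum>k=1..n. e j (u k)) = 0"
      by (subst sum.swap) fact
    ultimately show ?thesis
      by (simp add: h_def lin_def flip: sum_distrib_left)
  qed
  \<comment> \<open>The swap is a measure-preserving involution that reverses the sign of the
    increment; averaging the sum with its image antisymmetrises it.\<close>
  have pair: "2 * (\<Sum>u\<in>?U. (h (exch j k u) - h u) * \<psi> (h u)) =
      - (\<Sum>u\<in>?U. (h (exch j k u) - h u) * (\<psi> (h (exch j k u)) - \<psi> (h u)))"
    if "j \<in> {1..n}" "k \<in> {1..n}" for j k
  proof -
    have "(\<Sum>u\<in>?U. (h (exch j k u) - h u) * \<psi> (h u)) =
        (\<Sum>u\<in>?U. (h u - h (exch j k u)) * \<psi> (h (exch j k u)))"
      using sum_exch[OF that, of "\<lambda>u. (h (exch j k u) - h u) * \<psi> (h u)"] by simp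
    then have "2 * (\<Sum>u\<in>?U. (h (exch j k u) - h u) * \<psi> (h u)) =
        (\<Sum>u\<in>?U. (h (exch j k u) - h u) * \<psi> (h u)) +
        (\<Sum>u\<in>?U. (h u - h (exch j k u)) * \<psi> (h (exch j k u)))"
      by simp
    then show ?thesis
      by (simp add: sum_negf[symmetric] sum.distrib[symmetric] algebra_simps)
  qed
  have "4 * real n * (\<Sum>u\<in>?U. h u * \<psi> (h u)) =
      (\<Sum>u\<in>?U. - 2 * (\<Sum>j=1..n. \<Sum>k=1..n. h (exch j k u) - h u) * \<psi> (h u))"
  proof -
    have "(\<Sum>u\<in>?U. - 2 * (\<Sum>j=1..n. \<Sum>k=1..n. h (exch j k u) - h u) * \<psi> (h u)) =
        (\<Sum>u\<in>?U. 4 * real n * (h u * \<psi> (h u)))"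
    proof (intro sum.cong refl)
      fix u assume "u \<in> ?U"
      from eig[OF this]
      show "- 2 * (\<Sum>j=1..n. \<Sum>k=1..n. h (exch j k u) - h u) * \<psi> (h u) = 4 * real n * (h u * \<psi> (h u))"
        by simp
    qed
    then show ?thesis
      by (simp only: sum_distrib_left)
  qed
  also have "\<dots> = - (\<Sum>u\<in>?U. \<Sum>j=1..n. \<Sum>k=1..n. 2 * ((h (exch j k u) - h u) * \<psi> (h u)))"
    unfolding sum_negf[symmetric] sum_distrib_left sum_distrib_right
    by (intro sum.cong refl) (simp add: algebra_simps)
  also have "\<dots> = - (\<Sum>j=1..n. \<Sum>k=1..n. 2 * (\<Sum>u\<in>?U. (h (exch j k u) - h u) * \<psi> (h u)))"
    by (simp only: sum_distrib_left sum.swap[of _ _ ?U])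
  also have "\<dots> = (\<Sum>j=1..n. \<Sum>k=1..n. \<Sum>u\<in>?U.
      (h (exch j k u) - h u) * (\<psi> (h (exch j k u)) - \<psi> (h u)))"
    unfolding sum_negf[symmetric] by (intro sum.cong refl) (simp only: pair minus_minus)
  finally show ?thesis .
qed

lemma sum_gain_square_le:
  assumes u: "u \<in> multislice l n \<kappa>"
  shows "(\<Sum>j=1..n. \<Sum>k=1..n. (gain e j k (u j) (u k))\<^sup>2) \<le>
    16 * real n * (\<Sum>j=1..n. \<Sum>i=1..l. (e j i)\<^sup>2)"
proof -
  define q where "q j = (\<Sum>i=1..l. (e j i)\<^sup>2)" for j
  have q: "(e j (u k))\<^sup>2 \<le> q j" if "k \<in> {1..n}" for j k
    unfolding q_def using multislice_coord[OF u that]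
    by (intro member_le_sum) auto
  have four: "((a - b) - (c - d))\<^sup>2 \<le> 8 * x + 8 * y"
    if "a\<^sup>2 \<le> x" "b\<^sup>2 \<le> x" "c\<^sup>2 \<le> y" "d\<^sup>2 \<le> y" for a b c d x y :: real
  proof -
    have "((a - b) - (c - d))\<^sup>2 \<le> 4 * a\<^sup>2 + 4 * b\<^sup>2 + 4 * c\<^sup>2 + 4 * d\<^sup>2"
      using square_add_le[of "a - b" "d - c"] square_add_le[of a "- b"] square_add_le[of d "- c"]
      by (simp add: algebra_simps)
    with that show ?thesis
      by linarith
  qed
  have "(gain e j k (u j) (u k))\<^sup>2 \<le> 8 * q j + 8 * q k" if "j \<in> {1..n}" "k \<in> {1..n}" for j k
    unfolding gain_def using that by (intro four q)
  then have "(\<Sum>j=1..n. \<Sum>k=1..n. (gain e j k (u j) (u k))\<^sup>2) \<le> (\<Sum>j=1..n. \<Sum>k=1..n. 8 * q j + 8 * q k)"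
    by (intro sum_mono) auto
  also have "\<dots> = 16 * real n * (\<Sum>j=1..n. q j)"
    by (simp add: sum.distrib sum_distrib_left[symmetric])
  finally show ?thesis
    by (simp add: q_def)
qed

text \<open>\<open>exchangeable_pairs\<close> for the identity expresses the second moment through
  squared gains, which \<open>sum_gain_square_le\<close> bounds pointwise.\<close>

lemma sum_lin_square_le:
  assumes e: "\<And>i. i \<in> {1..l} \<Longrightarrow> (\<Sum>j=1..n. e j i) = 0" and n: "n > 0"
  shows "(\<Sum>u\<in>multislice l n \<kappa>. (lin n 0 e u)\<^sup>2) \<le>
    4 * (\<Sum>j=1..n. \<Sum>i=1..l. (e j i)\<^sup>2) * card (multislice l n \<kappa>)"
proof -
  let ?U = "multislice l n \<kappa>" and ?h = "lin n 0 e"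
  define P where "P = (\<Sum>j=1..n. \<Sum>i=1..l. (e j i)\<^sup>2)"
  have "4 * real n * (\<Sum>u\<in>?U. (?h u)\<^sup>2) = (\<Sum>j=1..n. \<Sum>k=1..n. \<Sum>u\<in>?U. (?h (exch j k u) - ?h u)\<^sup>2)"
    using exchangeable_pairs[where l = l and e = e and \<psi> = "\<lambda>x. x" and \<kappa> = \<kappa>, OF e]
    unfolding power2_eq_square .
  also have "\<dots> = (\<Sum>j=1..n. \<Sum>k=1..n. \<Sum>u\<in>?U. (gain e j k (u j) (u k))\<^sup>2)"
    by (intro sum.cong refl) (simp add: lin_exch)
  also have "\<dots> = (\<Sum>u\<in>?U. \<Sum>j=1..n. \<Sum>k=1..n. (gain e j k (u j) (u k))\<^sup>2)"
    by (simp only: sum.swap[of _ _ ?U])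
  also have "\<dots> \<le> (\<Sum>u\<in>?U. 16 * real n * P)"
    unfolding P_def by (intro sum_mono sum_gain_square_le)
  finally have "real n * (\<Sum>u\<in>?U. (?h u)\<^sup>2) \<le> real n * (4 * P * card ?U)"
    by (simp add: ac_simps)
  then show ?thesis
    using n by (simp add: P_def)
qed

text \<open>\<open>exchangeable_pairs\<close> for the cube: the increments reduce to squared gains
  times \<open>(lin n 0 e u)\<^sup>2\<close>. Since the total squared gain is bounded pointwise, the
  second moment bound finishes the proof.\<close>

lemma sum_lin_fourth_le:
  assumes e: "\<And>i. i \<in> {1..l} \<Longrightarrow> (\<Sum>j=1..n. e j i) = 0" and n: "n > 0"
  shows "(\<Sum>u\<in>multislice l n \<kappa>. (lin n 0 e u) ^ 4) \<le>
    48 * (\<Sum>j=1..n. \<Sum>i=1..l. (e j i)\<^sup>2)\<^sup>2 * card (multislice l n \<kappa>)"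
proof -
  let ?U = "multislice l n \<kappa>" and ?h = "lin n 0 e"
  define P where "P = (\<Sum>j=1..n. \<Sum>i=1..l. (e j i)\<^sup>2)"
  have P: "0 \<le> P"
    unfolding P_def by (intro sum_nonneg) auto
  \<comment> \<open>The difference of the two sides is half of the fourth power of
    \<open>y - x\<close>. The right side is symmetric, so that it becomes
    \<open>g u + g (exch j k u)\<close> below.\<close>
  have cube: "(y - x) * (y ^ 3 - x ^ 3) \<le> 3 / 2 * ((y - x)\<^sup>2 * x\<^sup>2 + (x - y)\<^sup>2 * y\<^sup>2)" for x y :: real
  proof -
    have "3 / 2 * ((y - x)\<^sup>2 * x\<^sup>2 + (x - y)\<^sup>2 * y\<^sup>2) - (y - x) * (y ^ 3 - x ^ 3) = ((y - x)\<^sup>2)\<^sup>2 / 2"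
      by (simp add: field_simps) algebra
    then show ?thesis
      using zero_le_power2[of "(y - x)\<^sup>2"] by linarith
  qed
  have "4 * real n * (\<Sum>u\<in>?U. (?h u) ^ 4) =
      (\<Sum>j=1..n. \<Sum>k=1..n. \<Sum>u\<in>?U. (?h (exch j k u) - ?h u) * ((?h (exch j k u)) ^ 3 - (?h u) ^ 3))"
    using exchangeable_pairs[where l = l and e = e and \<psi> = "\<lambda>x. x ^ 3" and \<kappa> = \<kappa>, OF e] by (simp flip: power_Suc)
  also have "\<dots> \<le> (\<Sum>j=1..n. \<Sum>k=1..n. \<Sum>u\<in>?U. 3 * ((?h (exch j k u) - ?h u)\<^sup>2 * (?h u)\<^sup>2))"
  proof (rule sum_mono, rule sum_mono)
    fix j k assume jk: "j \<in> {1..n}" "k \<in> {1..n}"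
    define g where "g u = (?h (exch j k u) - ?h u)\<^sup>2 * (?h u)\<^sup>2" for u
    have "(\<Sum>u\<in>?U. (?h (exch j k u) - ?h u) * ((?h (exch j k u)) ^ 3 - (?h u) ^ 3)) \<le>
        (\<Sum>u\<in>?U. 3 / 2 * (g u + g (exch j k u)))"
      unfolding g_def exch_exch by (intro sum_mono cube)
    also have "\<dots> = 3 / 2 * ((\<Sum>u\<in>?U. g u) + (\<Sum>u\<in>?U. g (exch j k u)))"
      by (simp only: sum.distrib flip: sum_distrib_left)
    also have "\<dots> = (\<Sum>u\<in>?U. 3 * g u)"
      by (simp add: sum_exch[OF jk] sum_distrib_left)
    finally show "(\<Sum>u\<in>?U. (?h (exch j k u) - ?h u) * ((?h (exch j k u)) ^ 3 - (?h u) ^ 3)) \<le>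
        (\<Sum>u\<in>?U. 3 * ((?h (exch j k u) - ?h u)\<^sup>2 * (?h u)\<^sup>2))"
      by (simp add: g_def)
  qed
  also have "\<dots> = (\<Sum>j=1..n. \<Sum>k=1..n. \<Sum>u\<in>?U. 3 * (gain e j k (u j) (u k))\<^sup>2 * (?h u)\<^sup>2)"
    by (intro sum.cong refl) (simp add: lin_exch)
  also have "\<dots> = (\<Sum>u\<in>?U. 3 * (\<Sum>j=1..n. \<Sum>k=1..n. (gain e j k (u j) (u k))\<^sup>2) * (?h u)\<^sup>2)"
    by (simp only: sum.swap[of _ _ ?U] sum_distrib_left sum_distrib_right)
  also have "\<dots> \<le> (\<Sum>u\<in>?U. 3 * (16 * real n * P) * (?h u)\<^sup>2)"
    unfolding P_def by (intro sum_mono mult_right_mono mult_left_mono sum_gain_square_le) auto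
  also have "\<dots> = 48 * real n * P * (\<Sum>u\<in>?U. (?h u)\<^sup>2)"
    unfolding sum_distrib_left by (simp add: mult.assoc)
  also have "\<dots> \<le> 48 * real n * P * (4 * P * card ?U)"
    using P sum_lin_square_le[where l = l and \<kappa> = \<kappa>, OF e n] unfolding P_def by (intro mult_left_mono) auto
  finally have "real n * (\<Sum>u\<in>?U. (?h u) ^ 4) \<le> real n * (48 * P\<^sup>2 * card ?U)"
    by (simp add: power2_eq_square ac_simps)
  then show ?thesis
    using n by (simp add: P_def)
qed

section \<open>The exceptional coordinate and the spread of the others\<close>

context balanced_multislice
begin

lemma U_nonempty: "U \<noteq> {}"
  using multislice_nonempty[where l = l and \<kappa> = \<kappa>] unfolding sum_\<kappa> .

lemma card_U_pos: "0 < real (card U)"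
  using U_nonempty finite_multislice[of l n \<kappa>] by (simp add: card_gt_0_iff)

text \<open>By Chebyshev each of the four words obtained from \<open>u\<close> by the two swaps has
  value further than 1/64 from {0,1} for at most a fraction \<open>4096 * \<epsilon>\<close> of the
  words. Together this is less than the frequency of the prescribed pattern, so some
  \<open>u\<close> with the pattern has all four values close, and
  \<open>bdist_parallelogram\<close> applies.\<close>

lemma gain_dichotomy:
  assumes bd: "(\<Sum>u\<in>U. (bdist (lin n c \<phi> u))\<^sup>2) \<le> \<epsilon> * real (card U)"
    and \<epsilon>: "16384 * \<epsilon> < (\<rho> / 2) ^ 4"
    and idx: "distinct [j, k, j', k']" "{j, k, j', k'} \<subseteq> {1..n}"
    and col: "{a, b, a', b'} \<subseteq> {1..l}"
  shows "\<bar>gain \<phi> j k a b\<bar> \<le> 1 / 32 \<or> \<bar>gain \<phi> j' k' a' b'\<bar> \<le> 1 / 32"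
proof -
  let ?f = "lin n c \<phi>"
  define far where "far \<sigma> = {u \<in> U. bdist (?f (\<sigma> u)) > 1 / 64}" for \<sigma>
  have far_le: "real (card (far \<sigma>)) \<le> 4096 * \<epsilon> * real (card U)"
    if "\<And>g :: (nat \<Rightarrow> nat) \<Rightarrow> real. (\<Sum>u\<in>U. g (\<sigma> u)) = (\<Sum>u\<in>U. g u)" for \<sigma>
  proof -
    have "real (card (far \<sigma>)) * (1 / 4096) = (\<Sum>u\<in>far \<sigma>. (1 / 64)\<^sup>2)"
      by (simp add: power2_eq_square)
    also have "\<dots> \<le> (\<Sum>u\<in>far \<sigma>. (bdist (?f (\<sigma> u)))\<^sup>2)"
      by (intro sum_mono power_mono) (auto simp: far_def)
    also have "\<dots> \<le> (\<Sum>u\<in>U. (bdist (?f (\<sigma> u)))\<^sup>2)"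
      by (intro sum_mono2) (auto simp: far_def finite_multislice)
    also have "\<dots> \<le> \<epsilon> * real (card U)"
      using bd that[of "\<lambda>u. (bdist (?f u))\<^sup>2"] by simp
    finally show ?thesis by simp
  qed
  let ?P = "{u \<in> U. u j = a \<and> u k = b \<and> u j' = a' \<and> u k' = b'}"
  let ?B = "far (\<lambda>u. u) \<union> far (exch j k) \<union> far (exch j' k') \<union> far (\<lambda>u. exch j' k' (exch j k u))"
  have "?P - ?B \<noteq> {}"
  proof
    assume "?P - ?B = {}"
    then have "?P \<subseteq> ?B" by blast
    moreover have "finite ?B"
      by (auto simp: far_def finite_multislice)
    ultimately have "card ?P \<le> card ?B"
      by (rule card_mono[rotated])
    also have "\<dots> \<le> card (far (\<lambda>u. u)) + card (far (exch j k)) + card (far (exch j' k'))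
        + card (far (\<lambda>u. exch j' k' (exch j k u)))"
      by (meson card_Un_le order_trans add_le_mono order_refl)
    finally have "real (card ?P) \<le> real (card (far (\<lambda>u. u))) + real (card (far (exch j k)))
        + real (card (far (exch j' k'))) + real (card (far (\<lambda>u. exch j' k' (exch j k u))))"
      by linarith
    moreover have jk: "j \<in> {1..n}" "k \<in> {1..n}" "j' \<in> {1..n}" "k' \<in> {1..n}"
      using idx(2) by auto
    have "(\<Sum>u\<in>U. g (exch j' k' (exch j k u))) = (\<Sum>u\<in>U. g u)" for g :: "(nat \<Rightarrow> nat) \<Rightarrow> real"
      using sum_exch[OF jk(1,2), of "\<lambda>u. g (exch j' k' u)"] sum_exch[OF jk(3,4), of g] by simp
    then have "real (card (far (\<lambda>u. exch j' k' (exch j k u)))) \<le> 4096 * \<epsilon> * real (card U)"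
      by (rule far_le)
    moreover have "real (card (far (\<lambda>u. u))) \<le> 4096 * \<epsilon> * real (card U)"
      by (rule far_le) simp
    moreover have "real (card (far (exch j k))) \<le> 4096 * \<epsilon> * real (card U)"
      using jk by (intro far_le sum_exch)
    moreover have "real (card (far (exch j' k'))) \<le> 4096 * \<epsilon> * real (card U)"
      using jk by (intro far_le sum_exch)
    moreover have "16384 * \<epsilon> * real (card U) < (\<rho> / 2) ^ 4 * real (card U)"
      using \<epsilon> card_U_pos by (rule mult_strict_right_mono)
    ultimately show False
      using card_pattern4[OF idx col] by linarith
  qed
  then obtain u where u: "u \<in> ?P" "u \<notin> ?B"
    by blast
  let ?s = "gain \<phi> j k a b" and ?t = "gain \<phi> j' k' a' b'"
  have "?f (exch j k u) = ?f u + ?s"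
    using u(1) idx(2) by (simp add: lin_exch)
  moreover have "?f (exch j' k' u) = ?f u + ?t"
    using u(1) idx(2) by (simp add: lin_exch)
  moreover have "?f (exch j' k' (exch j k u)) = ?f u + ?s + ?t"
    using u(1) idx by (simp add: lin_exch exch_apply)
  ultimately have "bdist (?f u) \<le> 1 / 64" "bdist (?f u + ?s) \<le> 1 / 64"
    "bdist (?f u + ?t) \<le> 1 / 64" "bdist (?f u + ?s + ?t) \<le> 1 / 64"
    using u by (simp_all add: far_def)
  then show ?thesis
    by (rule bdist_parallelogram)
qed

text \<open>The graph argument of \<open>star_or_small\<close> turns the threshold 1/32 into 1/16.
  The Rademacher weights are half gains, so this is exactly the bound that
  \<open>rademacher_mean_bdist\<close> asks for.\<close>

lemma exceptional_coordinate:
  assumes "(\<Sum>u\<in>U. (bdist (lin n c \<phi> u))\<^sup>2) \<le> \<epsilon> * real (card U)"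
    and "16384 * \<epsilon> < (\<rho> / 2) ^ 4"
  obtains J where "J \<in> {1..n}"
    "\<And>j k a b. \<lbrakk>j \<in> {1..n} - {J}; k \<in> {1..n} - {J}; a \<in> {1..l}; b \<in> {1..l}\<rbrakk>
      \<Longrightarrow> \<bar>gain \<phi> j k a b\<bar> \<le> 1 / 16"
proof -
  have "\<exists>J\<in>{1..n}. \<forall>j\<in>{1..n} - {J}. \<forall>k\<in>{1..n} - {J}. j \<noteq> k \<longrightarrow>
      (\<forall>x\<in>{1..l} \<times> {1..l}. \<bar>gain \<phi> j k (fst x) (snd x)\<bar> \<le> 2 * (1 / 32))"
  proof (rule star_or_small)
    show "\<bar>gain \<phi> k j (fst x) (snd x)\<bar> = \<bar>gain \<phi> j k (fst x) (snd x)\<bar>" for j k x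
      using gain_commute[of \<phi> k j] by simp
    show "\<bar>gain \<phi> j k (fst x) (snd x)\<bar> \<le>
        \<bar>gain \<phi> j p (fst x) (snd x)\<bar> + \<bar>gain \<phi> k p (fst x) (snd x)\<bar>" for j k p x
      using gain_trans[of \<phi> j k "fst x" "snd x" p] by linarith
  next
    fix j k j' k' x x'
    assume "distinct [j, k, j', k']" "{j, k, j', k'} \<subseteq> {1..n}" "x \<in> {1..l} \<times> {1..l}" "x' \<in> {1..l} \<times> {1..l}"
    then show "\<bar>gain \<phi> j k (fst x) (snd x)\<bar> \<le> 1 / 32 \<or> \<bar>gain \<phi> j' k' (fst x') (snd x')\<bar> \<le> 1 / 32"
      using assms by (intro gain_dichotomy) auto
  qed (use n in auto)
  then obtain J where J: "J \<in> {1..n}" and small: "\<And>j k a b. \<lbrakk>j \<in> {1..n} - {J}; k \<in> {1..n} - {J}; j \<noteq> k;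
      a \<in> {1..l}; b \<in> {1..l}\<rbrakk> \<Longrightarrow> \<bar>gain \<phi> j k a b\<bar> \<le> 1 / 16"
    by fastforce
  have "\<bar>gain \<phi> j k a b\<bar> \<le> 1 / 16"
    if "j \<in> {1..n} - {J}" "k \<in> {1..n} - {J}" "a \<in> {1..l}" "b \<in> {1..l}" for j k a b
    using small[OF that(1,2) _ that(3,4)] by (cases "j = k") (auto simp: gain_def)
  with J show ?thesis
    by (rule that)
qed

text \<open>Colour 1 serves as reference. Swapping the pairs around a median gives a Rademacher sum
  whose variance is bounded by the distance to {0,1}; conversely, a pair coloured 1 and
  \<open>i\<close> contributes the squared difference of its deviations, and such colourings are
  frequent.\<close>

lemma sum_deviation_le:
  assumes small: "\<And>j k a b. \<lbrakk>j \<in> T; k \<in> T; a \<in> {1..l}; b \<in> {1..l}\<rbrakk> \<Longrightarrow> \<bar>gain \<phi> j k a b\<bar> \<le> 1 / 16"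
    and T: "T \<subseteq> {1..n}" and i: "i \<in> {1..l}"
  obtains m where "\<rho>\<^sup>2 * real (card U) * (\<Sum>j\<in>T. (\<phi> j i - \<phi> j 1 - m)\<^sup>2) \<le>
    32800 * (\<Sum>u\<in>U. (bdist (lin n c \<phi> u))\<^sup>2)"
proof -
  define d where "d j = \<phi> j i - \<phi> j 1" for j
  have "finite T"
    using T finite_subset by blast
  from median_pairing[OF this, of d] obtain m ps where
    dist: "distinct (concat (map (\<lambda>(j, k). [j, k]) ps))"
    and sub: "set (concat (map (\<lambda>(j, k). [j, k]) ps)) \<subseteq> T"
    and le: "(\<Sum>j\<in>T. (d j - m)\<^sup>2) \<le> (\<Sum>(j, k)\<leftarrow>ps. (d j - d k)\<^sup>2)"
    by blast
  have mem: "j \<in> T" "k \<in> T" "j \<noteq> k" if "(j, k) \<in> set ps" for j k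
  proof -
    show "j \<in> T" "k \<in> T"
      using that sub by (auto simp: case_prod_unfold)
    have "distinct [j, k]"
      using that dist by (auto simp: distinct_concat_iff case_prod_unfold)
    then show "j \<noteq> k" by simp
  qed
  define w where "w u = map (\<lambda>(j, k). gain \<phi> j k (u j) (u k) / 2) ps" for u :: "nat \<Rightarrow> nat"
  have "(\<Sum>x\<leftarrow>w u. x\<^sup>2) \<le> 2050 * rademacher_mean (w u) (\<lambda>x. (bdist x)\<^sup>2) (lin n c \<phi> u + sum_list (w u))"
    if u: "u \<in> U" for u
  proof (rule rademacher_mean_bdist)
    fix x assume "x \<in> set (w u)"
    then obtain j k where jk: "(j, k) \<in> set ps" "x = gain \<phi> j k (u j) (u k) / 2"
      by (auto simp: w_def)
    then have "\<bar>gain \<phi> j k (u j) (u k)\<bar> \<le> 1 / 16"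
      using mem[OF jk(1)] T multislice_coord[OF u] by (intro small) auto
    then show "\<bar>x\<bar> \<le> 1 / 32"
      using jk by simp
  qed
  then have "(\<Sum>u\<in>U. \<Sum>x\<leftarrow>w u. x\<^sup>2) \<le>
      2050 * (\<Sum>u\<in>U. rademacher_mean (w u) (\<lambda>x. (bdist x)\<^sup>2) (lin n c \<phi> u + sum_list (w u)))"
    unfolding sum_distrib_left by (rule sum_mono)
  also have "(\<Sum>u\<in>U. rademacher_mean (w u) (\<lambda>x. (bdist x)\<^sup>2) (lin n c \<phi> u + sum_list (w u))) =
      (\<Sum>u\<in>U. (bdist (lin n c \<phi> u))\<^sup>2)"
    unfolding w_def by (rule sum_rademacher_mean_exch[OF dist]) (use sub T in blast)
  finally have upper: "(\<Sum>u\<in>U. \<Sum>x\<leftarrow>w u. x\<^sup>2) \<le> 2050 * (\<Sum>u\<in>U. (bdist (lin n c \<phi> u))\<^sup>2)" .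
  \<comment> \<open>The factor 16 collects the pattern frequency \<open>(\<rho> / 2)\<^sup>2\<close>
    and the halving of the gain; with 2050 it gives 32800.\<close>
  have pair: "\<rho>\<^sup>2 * real (card U) * (d j - d k)\<^sup>2 \<le> 16 * (\<Sum>u\<in>U. (gain \<phi> j k (u j) (u k) / 2)\<^sup>2)"
    if "(j, k) \<in> set ps" for j k
  proof -
    let ?P = "{u \<in> U. u j = 1 \<and> u k = i}"
    have "(\<rho> / 2)\<^sup>2 * real (card U) * ((d j - d k) / 2)\<^sup>2 \<le> real (card ?P) * ((d j - d k) / 2)\<^sup>2"
      using mem[OF that] T l i by (intro mult_right_mono card_pattern2) auto
    also have "\<dots> = (\<Sum>u\<in>?P. (gain \<phi> j k (u j) (u k) / 2)\<^sup>2)"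
      by (simp add: gain_def d_def)
    also have "\<dots> \<le> (\<Sum>u\<in>U. (gain \<phi> j k (u j) (u k) / 2)\<^sup>2)"
      by (intro sum_mono2) (auto simp: finite_multislice)
    finally show ?thesis
      by (simp add: power_divide)
  qed
  have "\<rho>\<^sup>2 * real (card U) * (\<Sum>j\<in>T. (d j - m)\<^sup>2) \<le> \<rho>\<^sup>2 * real (card U) * (\<Sum>(j, k)\<leftarrow>ps. (d j - d k)\<^sup>2)"
    using le by (intro mult_left_mono) auto
  also have "\<dots> = (\<Sum>p\<leftarrow>ps. \<rho>\<^sup>2 * real (card U) * (case p of (j, k) \<Rightarrow> (d j - d k)\<^sup>2))"
    by (simp add: sum_list_const_mult)
  also have "\<dots> \<le> (\<Sum>p\<leftarrow>ps. 16 * (\<Sum>u\<in>U. (case p of (j, k) \<Rightarrow> gain \<phi> j k (u j) (u k) / 2)\<^sup>2))"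
    by (intro sum_list_mono) (use pair in auto)
  also have "\<dots> = 16 * (\<Sum>u\<in>U. \<Sum>x\<leftarrow>w u. x\<^sup>2)"
  proof -
    have "(\<Sum>p\<leftarrow>qs. \<Sum>u\<in>U. h p u) = (\<Sum>u\<in>U. \<Sum>p\<leftarrow>qs. h p u)"
      for qs :: "(nat \<times> nat) list" and h :: "nat \<times> nat \<Rightarrow> (nat \<Rightarrow> nat) \<Rightarrow> real"
      by (induction qs) (auto simp: sum.distrib)
    then show ?thesis
      by (simp add: sum_list_const_mult w_def comp_def)
  qed
  also note upper
  finally show ?thesis
    by (intro that[of m]) (simp add: d_def)
qed

end

subsection \<open>The FKN theorem\<close>

lemma fourth_power_add_le: "(x + y) ^ 4 \<le> 8 * x ^ 4 + 8 * (y::real) ^ 4"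
proof -
  have "(x + y) ^ 4 = ((x + y)\<^sup>2)\<^sup>2"
    by simp
  also have "\<dots> \<le> (2 * x\<^sup>2 + 2 * y\<^sup>2)\<^sup>2"
    by (intro power_mono square_add_le) simp
  also have "\<dots> \<le> 2 * (2 * x\<^sup>2)\<^sup>2 + 2 * (2 * y\<^sup>2)\<^sup>2"
    by (rule square_add_le)
  finally show ?thesis
    by (simp add: power_mult_distrib)
qed

text \<open>Bounds, per unit of \<open>\<epsilon>\<close>, the total squared deviation over all
  coordinates and colours.\<close>

definition deviation_const :: "nat \<Rightarrow> real \<Rightarrow> real" where
  "deviation_const l \<rho> = 32800 * real l / \<rho>\<^sup>2"

text \<open>Bounds, per unit of \<open>\<epsilon>\<close>, the pointwise squared error of rounding
  the part that depends on the exceptional coordinate.\<close>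

definition rounding_const :: "nat \<Rightarrow> real \<Rightarrow> real" where
  "rounding_const l \<rho> = 2 * (2 + 8 * deviation_const l \<rho>) / \<rho>"

text \<open>
  The first summand is used for small \<open>\<epsilon>\<close>, the other two for \<open>16384 * \<epsilon> \<ge> (\<rho> / 2) ^ 4\<close>, where the
  zero function is a good enough approximation.
\<close>

definition fkn_const :: "nat \<Rightarrow> real \<Rightarrow> real" where
  "fkn_const l \<rho> = 32 * (48 * (deviation_const l \<rho>)\<^sup>2 + (rounding_const l \<rho>)\<^sup>2)
    + 16384 * (2 / \<rho>) ^ 4 + 2 * (16384 * (2 / \<rho>) ^ 4)\<^sup>2"

context balanced_multislice
begin

lemma fkn_small:
  assumes bd: "(\<Sum>u\<in>U. (bdist (lin n c \<phi> u))\<^sup>2) = \<epsilon> * real (card U)"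
    and \<epsilon>: "16384 * \<epsilon> < (\<rho> / 2) ^ 4"
  shows "\<exists>J\<in>{1..n}. \<exists>G. (\<forall>i. G i \<in> {0, 1}) \<and>
    (\<Sum>u\<in>U. (lin n c \<phi> u - G (u J))\<^sup>2) \<le> (\<epsilon> + fkn_const l \<rho> * \<epsilon>\<^sup>2) * real (card U)"
proof -
  define C1 C2 where "C1 = deviation_const l \<rho>" and "C2 = rounding_const l \<rho>"
  note C_defs = C1_def C2_def deviation_const_def rounding_const_def
  define M where "M = real (card U)"
  have M: "0 < M"
    unfolding M_def by (rule card_U_pos)
  have "0 \<le> \<epsilon> * M"
    unfolding M_def bd[symmetric] by (intro sum_nonneg) auto
  then have \<epsilon>0: "0 \<le> \<epsilon>"
    using M by (simp add: zero_le_mult_iff)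
  obtain J where J: "J \<in> {1..n}" and small:
    "\<And>j k a b. \<lbrakk>j \<in> {1..n} - {J}; k \<in> {1..n} - {J}; a \<in> {1..l}; b \<in> {1..l}\<rbrakk>
      \<Longrightarrow> \<bar>gain \<phi> j k a b\<bar> \<le> 1 / 16"
    using exceptional_coordinate[of c \<phi> \<epsilon>] bd \<epsilon> by auto
  define T where "T = {1..n} - {J}"
  define d where "d j i = \<phi> j i - \<phi> j 1" for j i
  define \<mu> where "\<mu> i = (\<Sum>j\<in>T. d j i) / card T" for i
  \<comment> \<open>The row of \<open>J\<close> is set to zero, so that the columns still sum to
    zero over all coordinates and the moment bounds apply unchanged.\<close>
  define e where "e j i = (if j = J then 0 else d j i - \<mu> i)" for j i
  define h where "h = lin n 0 e"
  define P where "P = (\<Sum>j=1..n. \<Sum>i=1..l. (e j i)\<^sup>2)"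
  have cardT: "card T = n - 1"
    using J by (simp add: T_def)
  then have T: "finite T" "T \<noteq> {}"
    using n(1) by (auto intro: card_ge_0_finite)
  have split: "(\<Sum>j=1..n. g j) = g J + (\<Sum>j\<in>T. g j)" for g :: "nat \<Rightarrow> real"
    unfolding T_def by (rule sum.remove[OF _ J]) simp
  have e0: "(\<Sum>j=1..n. e j i) = 0" for i
  proof -
    have "(\<Sum>j=1..n. e j i) = (\<Sum>j\<in>T. d j i - \<mu> i)"
      unfolding split by (auto simp: e_def T_def intro!: sum.cong)
    also have "\<dots> = 0"
      using T by (simp add: sum_subtractf \<mu>_def)
    finally show ?thesis .
  qed
  have "\<rho>\<^sup>2 * M * (\<Sum>j=1..n. (e j i)\<^sup>2) \<le> 32800 * (\<epsilon> * M)" if i: "i \<in> {1..l}" for i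
  proof -
    obtain m where m: "\<rho>\<^sup>2 * M * (\<Sum>j\<in>T. (\<phi> j i - \<phi> j 1 - m)\<^sup>2) \<le> 32800 * (\<epsilon> * M)"
      using sum_deviation_le[where T = T and \<phi> = \<phi> and i = i and c = c] small i
      unfolding T_def bd M_def by blast
    have "(\<Sum>j=1..n. (e j i)\<^sup>2) = (\<Sum>j\<in>T. (d j i - \<mu> i)\<^sup>2)"
      unfolding split by (auto simp: e_def T_def intro!: sum.cong)
    also have "\<dots> \<le> (\<Sum>j\<in>T. (\<phi> j i - \<phi> j 1 - m)\<^sup>2)"
      using sum_square_mean_le[OF T, of "\<lambda>j. d j i" m] by (simp add: \<mu>_def d_def)
    finally show ?thesis
      using m M by (elim order_trans[rotated] mult_left_mono) auto
  qed
  then have "(\<Sum>i=1..l. \<rho>\<^sup>2 * M * (\<Sum>j=1..n. (e j i)\<^sup>2)) \<le> (\<Sum>i=1..l. 32800 * (\<epsilon> * M))"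
    by (rule sum_mono)
  moreover have "P = (\<Sum>i=1..l. \<Sum>j=1..n. (e j i)\<^sup>2)"
    unfolding P_def by (rule sum.swap)
  ultimately have "\<rho>\<^sup>2 * M * P \<le> real l * (32800 * (\<epsilon> * M))"
    by (simp flip: sum_distrib_left)
  then have "M * (\<rho>\<^sup>2 * P) \<le> M * (32800 * real l * \<epsilon>)"
    by (simp add: ac_simps)
  then have "\<rho>\<^sup>2 * P \<le> 32800 * real l * \<epsilon>"
    using M by simp
  then have P: "P \<le> C1 * \<epsilon>"
    using \<rho> by (simp add: C_defs field_simps)
  have P0: "0 \<le> P"
    unfolding P_def by (intro sum_nonneg) auto
  have h2: "(\<Sum>u\<in>U. (h u)\<^sup>2) \<le> 4 * (C1 * \<epsilon>) * M"
  proof -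
    have "(\<Sum>u\<in>U. (h u)\<^sup>2) \<le> 4 * P * M"
      unfolding h_def P_def M_def by (rule sum_lin_square_le) (use e0 n in auto)
    also have "\<dots> \<le> 4 * (C1 * \<epsilon>) * M"
      using P M by simp
    finally show ?thesis .
  qed
  have h4: "(\<Sum>u\<in>U. (h u) ^ 4) \<le> 48 * (C1 * \<epsilon>)\<^sup>2 * M"
  proof -
    have "(\<Sum>u\<in>U. (h u) ^ 4) \<le> 48 * P\<^sup>2 * M"
      unfolding h_def P_def M_def by (rule sum_lin_fourth_le) (use e0 n in auto)
    also have "\<dots> \<le> 48 * (C1 * \<epsilon>)\<^sup>2 * M"
      using P P0 M by (intro mult_right_mono mult_left_mono power_mono) auto
    finally show ?thesis .
  qed
  \<comment> \<open>The means \<open>\<mu>\<close> are summed over all coordinates including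
    \<open>J\<close>, which gives a constant by \<open>sum_colours\<close>; the last bracket
    corrects the term at \<open>J\<close>.\<close>
  define q where "q i = c + (\<Sum>j=1..n. \<phi> j 1) + (\<Sum>i=1..l. real (\<kappa> i) * \<mu> i) + (d J i - \<mu> i)" for i
  have decomp: "lin n c \<phi> u = h u + q (u J)" if u: "u \<in> U" for u
  proof -
    have "(\<Sum>j=1..n. \<phi> j (u j)) = (\<Sum>j=1..n. \<phi> j 1 + e j (u j) + \<mu> (u j) + (if j = J then d J (u J) - \<mu> (u J) else 0))"
      by (intro sum.cong refl) (simp add: e_def d_def)
    also have "\<dots> = (\<Sum>j=1..n. \<phi> j 1) + h u + (\<Sum>i=1..l. real (\<kappa> i) * \<mu> i) + (d J (u J) - \<mu> (u J))"
      using J sum_colours[OF u, of \<mu>] by (simp add: sum.distrib h_def lin_def)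
    finally show ?thesis
      by (simp add: lin_def q_def)
  qed
  define G where "G i = (if \<bar>q i\<bar> \<le> \<bar>q i - 1\<bar> then 0 else 1 :: real)" for i
  define r where "r u = q (u J) - G (u J)" for u
  have G: "G i \<in> {0, 1}" for i
    by (simp add: G_def)
  have r: "(r u)\<^sup>2 = (bdist (q (u J)))\<^sup>2" for u
    by (auto simp: r_def G_def bdist_def min_def)
  have "(\<Sum>u\<in>U. (r u)\<^sup>2) \<le> (\<Sum>u\<in>U. 2 * (bdist (lin n c \<phi> u))\<^sup>2 + 2 * (h u)\<^sup>2)"
  proof (rule sum_mono)
    fix u assume u: "u \<in> U"
    show "(r u)\<^sup>2 \<le> 2 * (bdist (lin n c \<phi> u))\<^sup>2 + 2 * (h u)\<^sup>2"
      using bdist_triangle[of "q (u J)" "lin n c \<phi> u"] by (simp add: r decomp[OF u])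
  qed
  also have "\<dots> = 2 * (\<epsilon> * M) + 2 * (\<Sum>u\<in>U. (h u)\<^sup>2)"
    by (simp add: sum.distrib bd M_def flip: sum_distrib_left)
  also have "\<dots> \<le> (2 + 8 * C1) * \<epsilon> * M"
    using h2 by (simp add: algebra_simps)
  finally have r2: "(\<Sum>u\<in>U. (r u)\<^sup>2) \<le> (2 + 8 * C1) * \<epsilon> * M" .
  \<comment> \<open>The rounding error depends only on the colour at \<open>J\<close>, and each
    colour has frequency at least \<open>\<rho> / 2\<close> there. Its mean square bound is
    therefore also a uniform bound, which makes its fourth moment quadratic in
    \<open>\<epsilon>\<close>.\<close>
  have rmax: "(r u)\<^sup>2 \<le> C2 * \<epsilon>" if u: "u \<in> U" for u
  proof -
    have "\<rho> / 2 * M * (r u)\<^sup>2 \<le> real (card {v \<in> U. v J = u J}) * (r u)\<^sup>2"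
      unfolding M_def using J multislice_coord[OF u J] by (intro mult_right_mono card_pattern1) auto
    also have "\<dots> = (\<Sum>v\<in>{v \<in> U. v J = u J}. (r v)\<^sup>2)"
      by (simp add: r_def)
    also have "\<dots> \<le> (\<Sum>v\<in>U. (r v)\<^sup>2)"
      by (intro sum_mono2) (auto simp: finite_multislice)
    also note r2
    finally have "M * (\<rho> * (r u)\<^sup>2) \<le> M * (2 * (2 + 8 * C1) * \<epsilon>)"
      by (simp add: field_simps)
    then have "\<rho> * (r u)\<^sup>2 \<le> 2 * (2 + 8 * C1) * \<epsilon>"
      using M by (simp only: mult_le_cancel_left_pos)
    then show ?thesis
      using \<rho> by (simp add: C_defs field_simps)
  qed
  have r4: "(\<Sum>u\<in>U. (r u) ^ 4) \<le> (C2 * \<epsilon>)\<^sup>2 * M"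
  proof -
    have "(r u) ^ 4 \<le> (C2 * \<epsilon>)\<^sup>2" if "u \<in> U" for u
      using power_mono[OF rmax[OF that], of 2] by simp
    then have "(\<Sum>u\<in>U. (r u) ^ 4) \<le> (\<Sum>u\<in>U. (C2 * \<epsilon>)\<^sup>2)"
      by (rule sum_mono)
    then show ?thesis
      by (simp add: M_def mult.commute)
  qed
  have "(\<Sum>u\<in>U. (lin n c \<phi> u - G (u J))\<^sup>2) \<le>
      (\<Sum>u\<in>U. (bdist (lin n c \<phi> u))\<^sup>2 + (32 * (h u) ^ 4 + 32 * (r u) ^ 4))"
  proof (rule sum_mono)
    fix u assume u: "u \<in> U"
    have "(lin n c \<phi> u - G (u J)) ^ 4 \<le> 8 * (h u) ^ 4 + 8 * (r u) ^ 4"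
      using fourth_power_add_le[of "h u" "r u"] by (simp add: decomp[OF u] r_def algebra_simps)
    then show "(lin n c \<phi> u - G (u J))\<^sup>2 \<le> (bdist (lin n c \<phi> u))\<^sup>2 + (32 * (h u) ^ 4 + 32 * (r u) ^ 4)"
      using square_le_bdist_fourth[OF G, of "lin n c \<phi> u" "u J"] by linarith
  qed
  also have "\<dots> = \<epsilon> * M + 32 * (\<Sum>u\<in>U. (h u) ^ 4) + 32 * (\<Sum>u\<in>U. (r u) ^ 4)"
    by (simp add: sum.distrib bd M_def flip: sum_distrib_left)
  also have "\<dots> \<le> \<epsilon> * M + 32 * (48 * (C1 * \<epsilon>)\<^sup>2 * M) + 32 * ((C2 * \<epsilon>)\<^sup>2 * M)"
    using h4 r4 by linarith
  also have "\<dots> = (\<epsilon> + 32 * (48 * C1\<^sup>2 + C2\<^sup>2) * \<epsilon>\<^sup>2) * M"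
    by (simp add: power2_eq_square algebra_simps)
  also have "\<dots> \<le> (\<epsilon> + fkn_const l \<rho> * \<epsilon>\<^sup>2) * M"
    using M \<rho> by (intro mult_right_mono add_left_mono) (simp_all add: fkn_const_def C1_def C2_def)
  finally show ?thesis
    using J G unfolding M_def by blast
qed

lemma fkn_large:
  assumes bd: "(\<Sum>u\<in>U. (bdist (f u))\<^sup>2) = \<epsilon> * real (card U)"
    and \<epsilon>: "(\<rho> / 2) ^ 4 \<le> 16384 * \<epsilon>"
  shows "(\<Sum>u\<in>U. (f u)\<^sup>2) \<le> (\<epsilon> + fkn_const l \<rho> * \<epsilon>\<^sup>2) * real (card U)"
proof -
  define c where "c = 16384 * (2 / \<rho>) ^ 4"
  have c: "0 < c"
    using \<rho> by (simp add: c_def)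
  have "c * (\<rho> / 2) ^ 4 \<le> c * (16384 * \<epsilon>)"
    using c \<epsilon> by simp
  also have "c * (\<rho> / 2) ^ 4 = 16384"
    using \<rho> by (simp add: c_def power_divide)
  finally have one: "1 \<le> c * \<epsilon>"
    by simp
  then have \<epsilon>0: "0 \<le> \<epsilon>"
    using c by (smt (verit) mult_nonneg_nonpos)
  have "\<epsilon> * 1 \<le> \<epsilon> * (c * \<epsilon>)"
    using one \<epsilon>0 by (intro mult_left_mono) auto
  moreover have "1\<^sup>2 \<le> (c * \<epsilon>)\<^sup>2"
    using one by (intro power_mono) auto
  \<comment> \<open>One \<open>\<epsilon>\<close> is at most \<open>c * \<epsilon>\<^sup>2\<close>
    and the 2 is at most \<open>2 * (c * \<epsilon>)\<^sup>2\<close>, both because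
    \<open>c * \<epsilon>\<close> is at least 1.\<close>
  ultimately have "2 * \<epsilon> + 2 \<le> \<epsilon> + (c + 2 * c\<^sup>2) * \<epsilon>\<^sup>2"
    by (simp add: power2_eq_square algebra_simps)
  also have "\<dots> \<le> \<epsilon> + fkn_const l \<rho> * \<epsilon>\<^sup>2"
    by (intro add_left_mono mult_right_mono) (simp_all add: fkn_const_def c_def)
  finally have "(2 * \<epsilon> + 2) * real (card U) \<le> (\<epsilon> + fkn_const l \<rho> * \<epsilon>\<^sup>2) * real (card U)"
    by (rule mult_right_mono) simp
  moreover have "(\<Sum>u\<in>U. (f u)\<^sup>2) \<le> (\<Sum>u\<in>U. 2 * (bdist (f u))\<^sup>2 + 2)"
    by (intro sum_mono square_le_bdist)
  moreover have "\<dots> = (2 * \<epsilon> + 2) * real (card U)"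
    by (simp add: sum.distrib bd algebra_simps flip: sum_distrib_left)
  ultimately show ?thesis
    by linarith
qed

lemma degree1_lin:
  assumes "degree1 l n \<kappa> f"
  obtains c \<phi> where "\<And>u. u \<in> U \<Longrightarrow> f u = lin n c \<phi> u"
proof -
  obtain c a where f: "\<And>u. u \<in> U \<Longrightarrow> f u = c + (\<Sum>j=1..n. \<Sum>i=1..l. a j i * coord_var j i u)"
    using assms unfolding degree1_def by blast
  have "(\<Sum>i=1..l. a j i * coord_var j i u) = a j (u j)" if "u \<in> U" "j \<in> {1..n}" for u j
    using multislice_coord[OF that] by (simp add: coord_var_def if_distrib[of "(*) _"] cong: if_cong)
  then have "f u = lin n c a u" if "u \<in> U" for u
    unfolding f[OF that] lin_def using that by (intro arg_cong2[of _ _ _ _ "(+)"] sum.cong refl)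
  then show ?thesis
    by (rule that)
qed

lemma ms_expectation_iff:
  "ms_expectation l n \<kappa> g \<le> a \<longleftrightarrow> (\<Sum>u\<in>U. g u) \<le> a * real (card U)"
  "ms_expectation l n \<kappa> g = a \<longleftrightarrow> (\<Sum>u\<in>U. g u) = a * real (card U)"
  using card_U_pos by (auto simp: ms_expectation_sum[OF U_nonempty] field_simps)

lemma fkn:
  assumes f: "degree1 l n \<kappa> f" and \<epsilon>: "ms_expectation l n \<kappa> (\<lambda>u. (bdist (f u))\<^sup>2) = \<epsilon>"
  obtains g where "g \<in> U \<rightarrow> {0, 1}" "depends_single_coord l n \<kappa> g"
    "ms_expectation l n \<kappa> (\<lambda>u. (f u - g u)\<^sup>2) \<le> \<epsilon> + fkn_const l \<rho> * \<epsilon>\<^sup>2"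
proof -
  obtain c \<phi> where lin: "\<And>u. u \<in> U \<Longrightarrow> f u = lin n c \<phi> u"
    using degree1_lin[OF f] by blast
  have bd: "(\<Sum>u\<in>U. (bdist (lin n c \<phi> u))\<^sup>2) = \<epsilon> * real (card U)"
    using \<epsilon> unfolding ms_expectation_iff by (simp add: lin)
  have "\<exists>J\<in>{1..n}. \<exists>G. (\<forall>i. G i \<in> {0, 1}) \<and>
      (\<Sum>u\<in>U. (lin n c \<phi> u - G (u J))\<^sup>2) \<le> (\<epsilon> + fkn_const l \<rho> * \<epsilon>\<^sup>2) * real (card U)"
  proof (cases "16384 * \<epsilon> < (\<rho> / 2) ^ 4")
    case True
    with bd show ?thesis
      by (rule fkn_small)
  next
    case False
    then show ?thesis
      using fkn_large[OF bd] n by (intro bexI[of _ 1] exI[of _ "\<lambda>_. 0"]) auto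
  qed
  then obtain J G where "J \<in> {1..n}" "\<And>i. G i \<in> {0, 1}"
    and le: "(\<Sum>u\<in>U. (lin n c \<phi> u - G (u J))\<^sup>2) \<le> (\<epsilon> + fkn_const l \<rho> * \<epsilon>\<^sup>2) * real (card U)"
    by blast
  show ?thesis
  proof (rule that[of "\<lambda>u. G (u J)"])
    show "(\<lambda>u. G (u J)) \<in> U \<rightarrow> {0, 1}"
      using \<open>\<And>i. G i \<in> {0, 1}\<close> by blast
    show "depends_single_coord l n \<kappa> (\<lambda>u. G (u J))"
      unfolding depends_single_coord_def using \<open>J \<in> {1..n}\<close> by (intro bexI[of _ J]) auto
    show "ms_expectation l n \<kappa> (\<lambda>u. (f u - G (u J))\<^sup>2) \<le> \<epsilon> + fkn_const l \<rho> * \<epsilon>\<^sup>2"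
      unfolding ms_expectation_iff using le by (simp add: lin)
  qed
qed

section \<open>Boolean functions close to degree 1\<close>

lemma prob_neq_Boolean:
  assumes "F \<in> U \<rightarrow> {0, 1}" "g \<in> U \<rightarrow> {0, 1 :: real}"
  shows "ms_prob l n \<kappa> {u. F u \<noteq> g u} = ms_expectation l n \<kappa> (\<lambda>u. (F u - g u)\<^sup>2)"
proof -
  have "(F u - g u)\<^sup>2 = (if F u \<noteq> g u then 1 else 0)" if "u \<in> U" for u
    using funcset_mem[OF assms(1) that] funcset_mem[OF assms(2) that] by auto
  then have "(\<Sum>u\<in>U. (F u - g u)\<^sup>2) = real (card (U \<inter> {u. F u \<noteq> g u}))"
    by (simp add: sum.If_cases finite_multislice)
  then show ?thesis
    unfolding ms_expectation_sum[OF U_nonempty]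
    by (simp add: ms_pmf_def measure_pmf_of_set U_nonempty finite_multislice)
qed

lemma fkn_Boolean:
  assumes F: "F \<in> U \<rightarrow> {0, 1}" and \<epsilon>: "(ms_norm l n \<kappa> (proj_gt1 l n \<kappa> F))\<^sup>2 = \<epsilon>"
  obtains g where "g \<in> U \<rightarrow> {0, 1}" "depends_single_coord l n \<kappa> g"
    "ms_prob l n \<kappa> {u. F u \<noteq> g u} \<le> 4 * \<epsilon> + 2 * fkn_const l \<rho> * \<epsilon>\<^sup>2"
proof -
  define p where "p = proj_le1 l n \<kappa> F"
  have p: "degree1 l n \<kappa> p"
    using theI'[OF degree1_proj_unique_exists[OF U_nonempty, of F]]
    unfolding p_def proj_le1_def is_degree1_proj_def by blast
  have "0 \<le> ms_expectation l n \<kappa> (\<lambda>u. (proj_gt1 l n \<kappa> F u)\<^sup>2)"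
    by simp
  then have \<epsilon>': "ms_expectation l n \<kappa> (\<lambda>u. (F u - p u)\<^sup>2) = \<epsilon>"
    using \<epsilon> by (simp add: ms_norm_def proj_gt1_def p_def)
  define \<delta> where "\<delta> = ms_expectation l n \<kappa> (\<lambda>u. (bdist (p u))\<^sup>2)"
  have "0 \<le> \<delta>"
    by (simp add: \<delta>_def)
  have "(\<Sum>u\<in>U. (bdist (p u))\<^sup>2) \<le> (\<Sum>u\<in>U. (F u - p u)\<^sup>2)"
  proof (rule sum_mono)
    fix u assume "u \<in> U"
    then have "bdist (p u) \<le> \<bar>F u - p u\<bar>"
      using bdist_le[OF funcset_mem[OF F], of u "p u"] by (simp add: abs_minus_commute)
    from power_mono[OF this, of 2] show "(bdist (p u))\<^sup>2 \<le> (F u - p u)\<^sup>2"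
      by simp
  qed
  also have "\<dots> = \<epsilon> * real (card U)"
    using \<epsilon>' by (simp only: ms_expectation_iff)
  finally have "\<delta> \<le> \<epsilon>"
    unfolding \<delta>_def ms_expectation_iff .
  obtain g where g: "g \<in> U \<rightarrow> {0, 1}" "depends_single_coord l n \<kappa> g"
    and "ms_expectation l n \<kappa> (\<lambda>u. (p u - g u)\<^sup>2) \<le> \<delta> + fkn_const l \<rho> * \<delta>\<^sup>2"
    using fkn[OF p \<delta>_def[symmetric]] by blast
  note this(3)
  also have "\<delta> + fkn_const l \<rho> * \<delta>\<^sup>2 \<le> \<epsilon> + fkn_const l \<rho> * \<epsilon>\<^sup>2"
    using \<open>0 \<le> \<delta>\<close> \<open>\<delta> \<le> \<epsilon>\<close> by (intro add_mono mult_left_mono power_mono) (simp_all add: fkn_const_def)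
  finally have pg: "(\<Sum>u\<in>U. (p u - g u)\<^sup>2) \<le> (\<epsilon> + fkn_const l \<rho> * \<epsilon>\<^sup>2) * real (card U)"
    by (simp only: ms_expectation_iff)
  \<comment> \<open>Both \<open>F - p\<close> and \<open>p - g\<close> have mean square
    \<open>\<epsilon>\<close> to leading order; the factor 2 for the square of a sum yields the
    4.\<close>
  have "(\<Sum>u\<in>U. (F u - g u)\<^sup>2) \<le> (\<Sum>u\<in>U. 2 * (F u - p u)\<^sup>2 + 2 * (p u - g u)\<^sup>2)"
  proof (rule sum_mono)
    show "(F u - g u)\<^sup>2 \<le> 2 * (F u - p u)\<^sup>2 + 2 * (p u - g u)\<^sup>2" for u
      using square_add_le[of "F u - p u" "p u - g u"] by simp
  qed
  also have "\<dots> = 2 * (\<Sum>u\<in>U. (F u - p u)\<^sup>2) + 2 * (\<Sum>u\<in>U. (p u - g u)\<^sup>2)"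
    by (simp add: sum.distrib flip: sum_distrib_left)
  also have "(\<Sum>u\<in>U. (F u - p u)\<^sup>2) = \<epsilon> * real (card U)"
    using \<epsilon>' by (simp only: ms_expectation_iff)
  finally have "(\<Sum>u\<in>U. (F u - g u)\<^sup>2) \<le> (4 * \<epsilon> + 2 * fkn_const l \<rho> * \<epsilon>\<^sup>2) * real (card U)"
    using pg by (simp add: algebra_simps)
  then have "ms_prob l n \<kappa> {u. F u \<noteq> g u} \<le> 4 * \<epsilon> + 2 * fkn_const l \<rho> * \<epsilon>\<^sup>2"
    unfolding prob_neq_Boolean[OF F g(1)] ms_expectation_iff .
  with g show ?thesis
    by (rule that)
qed

end

theorem theorem1p1:
  fixes l :: nat and \<rho> :: real
  assumes "l \<ge> 2" and "\<rho> > 0"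
  shows "\<exists>(N::nat) (K::real). \<forall>(n::nat) (\<kappa> :: nat \<Rightarrow> nat).
    n \<ge> N \<longrightarrow>
    (\<forall>i\<in>{1..l}. \<kappa> i > 0 \<and> real (\<kappa> i) \<ge> \<rho> * real n) \<longrightarrow>
    (\<Sum>i=1..l. \<kappa> i) = n \<longrightarrow>
    (\<forall>(f :: (nat \<Rightarrow> nat) \<Rightarrow> real) (\<epsilon>::real).
       degree1 l n \<kappa> f \<and> ms_expectation l n \<kappa> (\<lambda>u. (infdist (f u) {0, 1})\<^sup>2) = \<epsilon> \<longrightarrow>
       (\<exists>g \<in> multislice l n \<kappa> \<rightarrow> {0, 1}. depends_single_coord l n \<kappa> g \<and>
          ms_expectation l n \<kappa> (\<lambda>u. (f u - g u)\<^sup>2) \<le> \<epsilon> + K * \<epsilon>\<^sup>2)) \<and>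
    (\<forall>(F :: (nat \<Rightarrow> nat) \<Rightarrow> real) (\<epsilon>::real).
       F \<in> multislice l n \<kappa> \<rightarrow> {0, 1} \<and> (ms_norm l n \<kappa> (proj_gt1 l n \<kappa> F))\<^sup>2 = \<epsilon> \<longrightarrow>
       (\<exists>g \<in> multislice l n \<kappa> \<rightarrow> {0, 1}. depends_single_coord l n \<kappa> g \<and>
          ms_prob l n \<kappa> {u. F u \<noteq> g u} \<le> 4 * \<epsilon> + K * \<epsilon>\<^sup>2))"
proof (intro exI allI impI)
  fix n :: nat and \<kappa> :: "nat \<Rightarrow> nat"
  \<comment> \<open>This \<open>N\<close> guarantees both size conditions of the locale, 5
    coordinates and \<open>6 \<le> \<rho> * real n\<close>.\<close>
  assume n: "n \<ge> nat \<lceil>6 / \<rho>\<rceil> + 5" and \<kappa>: "\<forall>i\<in>{1..l}. \<kappa> i > 0 \<and> real (\<kappa> i) \<ge> \<rho> * real n"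
    and sum: "(\<Sum>i=1..l. \<kappa> i) = n"
  have "6 / \<rho> \<le> real n"
    using n by linarith
  then have "6 \<le> \<rho> * real n"
    using \<open>\<rho> > 0\<close> by (simp add: field_simps)
  then interpret balanced_multislice l n \<kappa> \<rho>
    using assms n \<kappa> sum by unfold_locales auto
  \<comment> \<open>The common constant \<open>K\<close> is the doubled one from the Boolean part;
    the bound of the first part is weakened to it.\<close>
  have K: "fkn_const l \<rho> \<le> 2 * fkn_const l \<rho>"
    by (simp add: fkn_const_def)
  let ?part1 = "\<lambda>f \<epsilon>. \<exists>g \<in> multislice l n \<kappa> \<rightarrow> {0, 1}. depends_single_coord l n \<kappa> g \<and>
    ms_expectation l n \<kappa> (\<lambda>u. (f u - g u)\<^sup>2) \<le> \<epsilon> + 2 * fkn_const l \<rho> * \<epsilon>\<^sup>2"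
  have "?part1 f \<epsilon>" if f: "degree1 l n \<kappa> f \<and> ms_expectation l n \<kappa> (\<lambda>u. (infdist (f u) {0, 1})\<^sup>2) = \<epsilon>" for f \<epsilon>
  proof -
    obtain g where "g \<in> U \<rightarrow> {0, 1}" "depends_single_coord l n \<kappa> g"
      "ms_expectation l n \<kappa> (\<lambda>u. (f u - g u)\<^sup>2) \<le> \<epsilon> + fkn_const l \<rho> * \<epsilon>\<^sup>2"
      using fkn[of f \<epsilon>] f unfolding infdist_bool by blast
    moreover have "\<epsilon> + fkn_const l \<rho> * \<epsilon>\<^sup>2 \<le> \<epsilon> + 2 * fkn_const l \<rho> * \<epsilon>\<^sup>2"
      using K by (intro add_left_mono mult_right_mono) auto
    ultimately show ?thesis
      by (meson order_trans)
  qed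
  moreover have "\<exists>g \<in> multislice l n \<kappa> \<rightarrow> {0, 1}. depends_single_coord l n \<kappa> g \<and>
      ms_prob l n \<kappa> {u. F u \<noteq> g u} \<le> 4 * \<epsilon> + 2 * fkn_const l \<rho> * \<epsilon>\<^sup>2"
    if "F \<in> multislice l n \<kappa> \<rightarrow> {0, 1} \<and> (ms_norm l n \<kappa> (proj_gt1 l n \<kappa> F))\<^sup>2 = \<epsilon>" for F \<epsilon>
    using fkn_Boolean[of F \<epsilon>] that by blast
  ultimately show "(\<forall>(f :: (nat \<Rightarrow> nat) \<Rightarrow> real) (\<epsilon>::real).
       degree1 l n \<kappa> f \<and> ms_expectation l n \<kappa> (\<lambda>u. (infdist (f u) {0, 1})\<^sup>2) = \<epsilon> \<longrightarrow>
       (\<exists>g \<in> multislice l n \<kappa> \<rightarrow> {0, 1}. depends_single_coord l n \<kappa> g \<and>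
          ms_expectation l n \<kappa> (\<lambda>u. (f u - g u)\<^sup>2) \<le> \<epsilon> + (2 * fkn_const l \<rho>) * \<epsilon>\<^sup>2)) \<and>
    (\<forall>(F :: (nat \<Rightarrow> nat) \<Rightarrow> real) (\<epsilon>::real).
       F \<in> multislice l n \<kappa> \<rightarrow> {0, 1} \<and> (ms_norm l n \<kappa> (proj_gt1 l n \<kappa> F))\<^sup>2 = \<epsilon> \<longrightarrow>
       (\<exists>g \<in> multislice l n \<kappa> \<rightarrow> {0, 1}. depends_single_coord l n \<kappa> g \<and>
          ms_prob l n \<kappa> {u. F u \<noteq> g u} \<le> 4 * \<epsilon> + (2 * fkn_const l \<rho>) * \<epsilon>\<^sup>2))"
    by blast
qed

end
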